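(* Let $P\subset\mathbb{R}^d$ be a smooth polytope of dimension $d\le 5$, and let $L_P(m)=|mP\cap\mathbb{Z}^d|$ be its Ehrhart polynomial. If $z\in\mathbb{C}$ is a root of $L_P$, then $\operatorname{Re} z=-1/2$.
   Context: A $d$-dimensional convex lattice polytope $P\subset\mathbb{R}^d$ is called smooth if it contains the origin in its interior and the vertices of every facet of $P$ form a $\mathbb{Z}$-basis of $\mathbb{Z}^d$ (smooth Fano polytope). For a lattice polytope $P$, $L_P(m):=|mP\cap\mathbb{Z}^d|$ for $m\in\mathbb{Z}_{\ge0}$; it is a polynomial in $m$ of degree $d$ (the Ehrhart polynomial), and roots refer to roots of this polynomial. *)

theory Defs
  imports "HOL-Analysis.Analysis" "HOL-Computational_Algebra.Polynomial"
begin

definition integer_lattice :: "(real ^ 'n) set" where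
  "integer_lattice = {x. \<forall>i. x $ i \<in> \<int>}"

definition lattice_polytope :: "(real ^ 'n) set \<Rightarrow> bool" where
  "lattice_polytope P \<longleftrightarrow>
     (\<exists>V. finite V \<and> V \<subseteq> integer_lattice \<and> P = convex hull V)"

text \<open>The additive group of the space as a module over the integers; its notions of span and
  independence are those with integer coefficients.\<close>

global_interpretation int_module: module "\<lambda>(k::int) (x::real ^ 'n). of_int k *\<^sub>R x"
  by standard (simp_all add: algebra_simps)

definition lattice_basis :: "(real ^ 'n) set \<Rightarrow> bool" where
  "lattice_basis B \<longleftrightarrow> int_module.independent B \<and> int_module.span B = integer_lattice"

definition smooth_polytope :: "(real ^ 'n) set \<Rightarrow> bool" where
  "smooth_polytope P \<longleftrightarrow>
     lattice_polytope P \<and> aff_dim P = int CARD('n) \<and> 0 \<in> interior P \<and>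
     (\<forall>F. F facet_of P \<longrightarrow> lattice_basis {v. v extreme_point_of F})"

definition ehrhart_count :: "(real ^ 'n) set \<Rightarrow> nat \<Rightarrow> nat" where
  "ehrhart_count P m = card ((\<lambda>x. real m *\<^sub>R x) ` P \<inter> integer_lattice)"

text \<open>A polynomial is determined by its values at the natural numbers, and by Ehrhart's theorem
  one with the required values exists for every lattice polytope. Complex coefficients are used
  so that its complex roots can be referred to directly.\<close>

definition ehrhart_poly :: "(real ^ 'n) set \<Rightarrow> complex poly" where
  "ehrhart_poly P = (THE p. \<forall>m. poly p (of_nat m) = of_nat (ehrhart_count P m))"

end

theory Submission
  imports Defs
begin

text \<open>
  The vertex sets of the facets of \<open>P\<close> form a complete fan of unimodular cones. Choosing a generic
  vector \<open>x\<close> makes these cones half-open so that they partition the space, which gives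
  \<open>L(m) = \<Sum>i. h i * (m + d - i choose d)\<close>, where \<open>h i\<close> counts the facets on which \<open>x\<close> has \<open>i\<close>
  negative coordinates; \<open>x\<close> and \<open>-x\<close> give the same polynomial, so \<open>h\<close> is palindromic. Hence for
  \<open>d \<le> 5\<close> the polynomial is, up to a factor \<open>2m + 1\<close>, a polynomial of degree at most two in
  \<open>m\<^sup>2 + m\<close>, and the claim says that its roots are real and at most \<open>-1/4\<close>.

  The needed inequalities between \<open>h 1\<close> and \<open>h 2\<close> are the bound \<open>h 1 \<le> 2 d\<close> on the number of
  vertices (from a facet whose cone contains the sum of all vertices), the trivial bound on the
  number of edges, and the consequence of \<open>-K \<cdot> C \<ge> 1\<close> for the torus-invariant curves \<open>C\<close> of the
  toric variety of the fan, summed over all \<open>C\<close>. The latter rests on the formula for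
  \<open>c\<^sub>1 c\<^sub>d\<^sub>-\<^sub>1\<close> in terms of \<open>h\<close>. It is obtained here by showing that a sum of products of sawtooth
  functions of the coordinates of \<open>x\<close>, corrected by a quadratic sawtooth term weighted with the
  intersection numbers, is constant in \<open>x\<close>, that averaging over 2-torsion translates multiplies
  this constant by \<open>1/4\<close>, and evaluating it near the origin.
\<close>

section \<open>The fan of a smooth Fano polytope\<close>

definition coord :: "(real ^ 'n) set \<Rightarrow> real ^ 'n \<Rightarrow> real ^ 'n \<Rightarrow> real" where
  "coord B v y = representation B y v"

definition ht :: "(real ^ 'n) set \<Rightarrow> real ^ 'n \<Rightarrow> real" where
  "ht B y = (\<Sum>v\<in>B. coord B v y)"

text \<open>The set \<open>\<B>\<close> consists of the vertex sets of the facets. Two cones over facets can only meet in a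
  common face; here this is a consequence of \<open>ht_nonpos\<close>, the convexity of the polytope.\<close>

locale smooth_fano =
  fixes \<B> :: "(real ^ 'n) set set"
  assumes finite_cones: "finite \<B>"
    and indep: "B \<in> \<B> \<Longrightarrow> independent B"
    and spanning: "B \<in> \<B> \<Longrightarrow> span B = UNIV"
    and vertices_lattice: "B \<in> \<B> \<Longrightarrow> B \<subseteq> integer_lattice"
    and coord_Ints: "B \<in> \<B> \<Longrightarrow> v \<in> B \<Longrightarrow> y \<in> integer_lattice \<Longrightarrow> coord B v y \<in> \<int>"
    and covering: "\<exists>B\<in>\<B>. \<forall>v\<in>B. 0 \<le> coord B v y"
    and ht_nonpos: "B \<in> \<B> \<Longrightarrow> C \<in> \<B> \<Longrightarrow> w \<in> C \<Longrightarrow> w \<notin> B \<Longrightarrow> ht B w \<le> 0"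
begin

section \<open>Dual coordinates, heights and disjointness of open cones\<close>

lemma finite_B: "B \<in> \<B> \<Longrightarrow> finite B"
  using indep finiteI_independent by blast

lemma card_B: 
  assumes "B \<in> \<B>" shows "card B = CARD('n)"
proof -
  have "dim (UNIV :: (real^'n) set) = card B"
    using indep[OF assms] spanning[OF assms] by (metis dim_span_eq_card_independent)
  then show ?thesis by (simp add: dim_UNIV)
qed

lemma linear_coord: 
  assumes "B \<in> \<B>" shows "linear (coord B v)"
  unfolding coord_def
  by (rule linearI) (simp_all add: representation_add[OF indep[OF assms]] 
      representation_scale[OF indep[OF assms]] spanning[OF assms])

lemmas coord_add = linear_add[OF linear_coord]
  and coord_scale = linear_cmul[OF linear_coord]
  and coord_diff = linear_diff[OF linear_coord]
  and coord_neg = linear_neg[OF linear_coord]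
  and coord_sum = linear_sum[OF linear_coord]
  and coord_zero = linear_0[OF linear_coord]

lemma coord_basis: "B \<in> \<B> \<Longrightarrow> w \<in> B \<Longrightarrow> coord B v w = (if v = w then 1 else 0)"
  unfolding coord_def using representation_basis[OF indep] by auto

lemma coord_expand: 
  assumes "B \<in> \<B>" shows "(\<Sum>v\<in>B. coord B v y *\<^sub>R v) = y"
  unfolding coord_def
  by (rule real_vector.sum_representation_eq) (auto simp: indep spanning finite_B assms)

lemma coord_lincomb: 
  assumes "B \<in> \<B>" "v \<in> B" shows "coord B v (\<Sum>w\<in>B. c w *\<^sub>R w) = c v"
proof -
  have "coord B v (\<Sum>w\<in>B. c w *\<^sub>R w) = (\<Sum>w\<in>B. c w * (if v = w then 1 else 0))"
    using assms by (simp add: coord_sum coord_scale coord_basis)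
  also have "\<dots> = c v" using assms finite_B by (simp add: sum.delta if_distrib cong: if_cong)
  finally show ?thesis .
qed

lemma coord_eqI:
  assumes "B \<in> \<B>" "\<And>v. v \<in> B \<Longrightarrow> coord B v y = coord B v z" shows "y = z"
  using coord_expand[OF assms(1), of y] coord_expand[OF assms(1), of z] assms(2) by (metis (no_types, lifting) sum.cong)

lemma linear_ht: "B \<in> \<B> \<Longrightarrow> linear (ht B)"
  unfolding ht_def by (intro linear_compose_sum ballI linear_coord)

lemmas ht_scale = linear_cmul[OF linear_ht]
  and ht_sum = linear_sum[OF linear_ht]
  and ht_zero = linear_0[OF linear_ht]

lemma ht_basis: "B \<in> \<B> \<Longrightarrow> w \<in> B \<Longrightarrow> ht B w = 1"
  unfolding ht_def using finite_B by (simp add: coord_basis)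

lemma ht_Ints: "B \<in> \<B> \<Longrightarrow> y \<in> integer_lattice \<Longrightarrow> ht B y \<in> \<int>"
  unfolding ht_def by (auto intro: Ints_sum coord_Ints)

lemma ht_le_1: "B \<in> \<B> \<Longrightarrow> C \<in> \<B> \<Longrightarrow> w \<in> C \<Longrightarrow> ht B w \<le> 1"
  using ht_nonpos[of B C w] ht_basis[of B w] by (cases "w \<in> B") auto

lemma ht_eq_sum_coord: 
  assumes "B \<in> \<B>" "C \<in> \<B>" shows "ht B y = (\<Sum>v\<in>C. coord C v y * ht B v)"
proof -
  have "ht B y = ht B (\<Sum>v\<in>C. coord C v y *\<^sub>R v)" using coord_expand[OF assms(2)] by simp
  also have "\<dots> = (\<Sum>v\<in>C. coord C v y * ht B v)" using assms(1) by (simp add: ht_sum ht_scale)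
  finally show ?thesis .
qed

text \<open>In the expansion of \<open>y\<close> over \<open>C\<close> all coefficients are
  nonnegative, and each vertex of \<open>C\<close> has \<open>C\<close>-height 1 but
  \<open>B\<close>-height at most 1. Hence the height over any facet whose cone contains
  \<open>y\<close> is the gauge of the polytope at \<open>y\<close>.\<close>

lemma ht_max:
  assumes "B \<in> \<B>" "C \<in> \<B>" "\<And>v. v \<in> C \<Longrightarrow> 0 \<le> coord C v y"
  shows "ht B y \<le> ht C y"
  unfolding ht_eq_sum_coord[OF assms(1,2), of y]
  unfolding ht_def[of C] using assms ht_le_1[OF assms(1,2)]
  by (intro sum_mono) (metis mult.right_neutral mult_left_mono)

text \<open>A vertex of \<open>C\<close> outside \<open>B\<close> has \<open>B\<close>-height at
  most 0 instead of 1, so occurring in \<open>y\<close> with a positive coefficient it would make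
  the inequality of \<open>ht_max\<close> strict.\<close>

lemma ht_max_eq:
  assumes "B \<in> \<B>" "C \<in> \<B>" "\<And>v. v \<in> C \<Longrightarrow> 0 \<le> coord C v y" "ht B y = ht C y"
    and "v \<in> C" "coord C v y > 0"
  shows "v \<in> B"
proof (rule ccontr)
  assume "v \<notin> B"
  then have le: "ht B v \<le> 0" using assms ht_nonpos by blast
  have "ht B y < ht C y"
    unfolding ht_eq_sum_coord[OF assms(1,2), of y] unfolding ht_def[of C]
  proof (rule sum_strict_mono_ex1)
    show "finite C" using assms finite_B by blast
    show "\<forall>w\<in>C. coord C w y * ht B w \<le> coord C w y"
      using assms ht_le_1[OF assms(1,2)] by (metis mult.right_neutral mult_left_mono)
    show "\<exists>w\<in>C. coord C w y * ht B w < coord C w y"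
      using assms(5,6) le by (intro bexI[of _ v]) (smt (verit, best) mult_nonneg_nonpos, auto)
  qed
  with assms show False by simp
qed

lemma open_cones_disjoint:
  assumes "B \<in> \<B>" "C \<in> \<B>" "\<And>v. v \<in> B \<Longrightarrow> 0 < coord B v y" "\<And>v. v \<in> C \<Longrightarrow> 0 < coord C v y"
  shows "B = C"
proof -
  have "ht B y = ht C y"
    using assms by (intro antisym ht_max) (auto intro: less_imp_le)
  then have "C \<subseteq> B" using ht_max_eq[OF assms(1,2), of y] assms(4) by (meson less_imp_le subsetI)
  then show ?thesis using card_B assms finite_B by (metis card_subset_eq)
qed

text \<open>By pigeonhole one cone contains infinitely many of the points \<open>Y k\<close>, which
  tend to \<open>y\<close> along the direction \<open>x\<close>. Such a cone contains an initial
  piece of the ray from \<open>y\<close> in direction \<open>x\<close>.\<close>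

lemma covering_germ:
  obtains C where "C \<in> \<B>" "\<And>u. u \<in> C \<Longrightarrow> 0 \<le> coord C u y"
    and "\<And>u. u \<in> C \<Longrightarrow> coord C u y = 0 \<Longrightarrow> 0 \<le> coord C u x"
proof -
  define Y where "Y k = y + inverse (real (Suc k)) *\<^sub>R x" for k
  have "\<forall>k. \<exists>C\<in>\<B>. \<forall>v\<in>C. 0 \<le> coord C v (Y k)" using covering by blast
  then obtain f where f: "\<And>k. f k \<in> \<B>" "\<And>k u. u \<in> f k \<Longrightarrow> 0 \<le> coord (f k) u (Y k)" by metis
  have "finite (range f)" using f finite_cones by (metis finite_subset image_subsetI)
  then obtain C where C: "C \<in> range f" and inf: "infinite (f -` {C})"
    using inf_img_fin_dom[of f UNIV] by auto
  have CB: "C \<in> \<B>" using C f by auto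
  have Ck: "\<exists>k>N. 0 \<le> coord C u y * real (Suc k) + coord C u x" if "u \<in> C" for u N
  proof -
    obtain k where k: "k \<in> f -` {C}" "k > N" using inf by (meson infinite_nat_iff_unbounded)
    have "0 \<le> coord C u (Y k)" using f(2)[of u k] k that by auto
    then have "0 \<le> coord C u y * real (Suc k) + coord C u x"
      using CB by (simp add: Y_def coord_add coord_scale field_simps)
    then show ?thesis using k by blast
  qed
  have "0 \<le> coord C u y" if "u \<in> C" for u
  proof (rule ccontr)
    assume neg: "\<not> ?thesis"
    \<comment> \<open>From \<open>N\<close> on, the negative term
      \<open>coord C u y * real (Suc k)\<close> outweighs \<open>coord C u x\<close>.\<close>
    obtain N where N: "coord C u x / - coord C u y < real N" using reals_Archimedean2 by blast
    obtain k where k: "k > N" "0 \<le> coord C u y * real (Suc k) + coord C u x" using Ck \<open>u \<in> C\<close> by blast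
    have "coord C u x < - coord C u y * real N" using N neg by (simp add: field_simps)
    moreover have "- coord C u y * real N \<le> - coord C u y * real (Suc k)"
      using neg k(1) by (intro mult_left_mono) auto
    ultimately show False using k by linarith
  qed
  moreover have "0 \<le> coord C u x" if "u \<in> C" "coord C u y = 0" for u
    using Ck[of u 0] that by auto
  ultimately show ?thesis using that CB by blast
qed

text \<open>By \<open>ht_max_eq\<close>, every cone containing a point of the relative interior of
  the ridge contains all vertices of the ridge. Leaving such a point in direction \<open>- v\<close>
  selects a cone other than that of \<open>B\<close>.\<close>

lemma ridge_covering:
  assumes "B \<in> \<B>" "v \<in> B"
  obtains C where "C \<in> \<B>" "B - {v} \<subseteq> C" "C \<noteq> B"
proof -
  define y where "y = (\<Sum>w\<in>B. (if w = v then 0 else 1) *\<^sub>R w)"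
  have y: "coord B u y = (if u = v then 0 else 1)" if "u \<in> B" for u
    using assms that unfolding y_def by (simp add: coord_lincomb)
  obtain C where C: "C \<in> \<B>" "\<And>u. u \<in> C \<Longrightarrow> 0 \<le> coord C u y"
    and C': "\<And>u. u \<in> C \<Longrightarrow> coord C u y = 0 \<Longrightarrow> 0 \<le> coord C u (- v)"
    by (rule covering_germ[of y "- v"]) blast
  have posB: "0 \<le> coord B u y" if "u \<in> B" for u using y that by simp
  have eq: "ht C y = ht B y"
    using assms C posB by (intro antisym ht_max) auto
  have "B - {v} \<subseteq> C"
    using ht_max_eq[OF C(1) assms(1) posB eq] y by (metis DiffE insertI1 subsetI zero_less_one)
  moreover have "C \<noteq> B"
    using C'[of v] assms y by (auto simp: coord_neg coord_basis)
  ultimately show ?thesis using that C by blast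
qed

lemma neighbour_exists:
  assumes "B \<in> \<B>" "v \<in> B"
  shows "\<exists>v'. v' \<notin> B \<and> insert v' (B - {v}) \<in> \<B>"
proof -
  obtain C where C: "C \<in> \<B>" "B - {v} \<subseteq> C" "C \<noteq> B" using ridge_covering[OF assms] .
  have fin: "finite B" "finite C" using finite_B assms C by auto
  have "card (C - (B - {v})) = 1"
    using C fin card_B[OF C(1)] card_B[OF assms(1)] assms
    by (subst card_Diff_subset) (auto simp: card_gt_0_iff)
  then obtain v' where v': "C - (B - {v}) = {v'}" using card_1_singletonE by blast
  then have "C = insert v' (B - {v})" using C by auto
  moreover have "v' \<notin> B" using v' C calculation assms by (cases "v' = v") (auto simp: insert_absorb)
  ultimately show ?thesis using C by auto
qed

text \<open>The change of basis across a ridge is governed by \<open>l\<close>, its determinant.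
  Unimodularity of both cones makes \<open>l\<close> a unit, disjointness of the open cones makes it
  \<open>- 1\<close>, and the coordinate formulas follow by substitution.\<close>

lemma coord_exchange:
  assumes "B \<in> \<B>" "v \<in> B" "v' \<notin> B" "insert v' (B - {v}) \<in> \<B>"
  shows "coord B v v' = - 1"
    and "coord (insert v' (B - {v})) v' z = - coord B v z"
    and "w \<in> B - {v} \<Longrightarrow> coord (insert v' (B - {v})) w z = coord B w z + coord B w v' * coord B v z"
proof -
  let ?C = "insert v' (B - {v})"
  define l where "l = coord B v v'"
  have fin: "finite B" using assms finite_B by blast
  have l: "coord B v z = coord ?C v' z * l" for z
  proof -
    have "coord B v z = coord B v (\<Sum>w\<in>?C. coord ?C w z *\<^sub>R w)" using coord_expand[OF assms(4)] by simp
    also have "\<dots> = (\<Sum>w\<in>?C. coord ?C w z * coord B v w)" using assms by (simp add: coord_sum coord_scale)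
    also have "\<dots> = coord ?C v' z * l + (\<Sum>w\<in>B - {v}. coord ?C w z * coord B v w)"
      using assms fin by (simp add: l_def)
    also have "(\<Sum>w\<in>B - {v}. coord ?C w z * coord B v w) = 0"
      using assms by (intro sum.neutral) (auto simp: coord_basis)
    finally show ?thesis by simp
  qed
  have expand_v': "v' = l *\<^sub>R v + (\<Sum>w\<in>B - {v}. coord B w v' *\<^sub>R w)"
    using coord_expand[OF assms(1), of v'] assms fin by (simp add: l_def sum.remove)
  have coordw: "coord ?C w z = coord B w z - coord B w v' * coord ?C v' z" if w: "w \<in> B - {v}" for w z
  proof -
    have "coord B w z = coord B w (\<Sum>u\<in>?C. coord ?C u z *\<^sub>R u)" using coord_expand[OF assms(4)] by simp
    also have "\<dots> = (\<Sum>u\<in>?C. coord ?C u z * coord B w u)" using assms by (simp add: coord_sum coord_scale)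
    also have "\<dots> = coord ?C v' z * coord B w v' + (\<Sum>u\<in>B - {v}. coord ?C u z * coord B w u)"
      using assms fin by simp
    also have "(\<Sum>u\<in>B - {v}. coord ?C u z * coord B w u) = (\<Sum>u\<in>B - {v}. if u = w then coord ?C w z else 0)"
      using assms by (intro sum.cong) (auto simp: coord_basis)
    also have "\<dots> = coord ?C w z" using w fin by simp
    finally show ?thesis by (simp add: algebra_simps)
  qed
  have one: "coord ?C v' v * l = 1" using l[of v] assms by (simp add: coord_basis)
  have "l \<in> \<int>" "coord ?C v' v \<in> \<int>"
    using assms vertices_lattice unfolding l_def by (auto intro!: coord_Ints)
  then obtain i j :: int where "l = of_int i" "coord ?C v' v = of_int j" by (auto elim!: Ints_cases)
  with one have "j * i = 1" by (metis of_int_eq_1_iff of_int_mult)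
  then have "i = 1 \<or> i = - 1" using zmult_eq_1_iff by blast
  then have "l = 1 \<or> l = - 1" using \<open>l = of_int i\<close> by auto
  moreover have "l \<noteq> 1"
  proof
    \<comment> \<open>Then both cones lie on the same side of the ridge. Adding to \<open>v'\<close>
      a multiple of the ridge vertices that outweighs all coordinates of \<open>v'\<close> gives a
      point interior to both cones.\<close>
    assume l1: "l = 1"
    define M where "M = (\<Sum>w\<in>B - {v}. \<bar>coord B w v'\<bar>) + 1"
    define y where "y = v' + (\<Sum>w\<in>B - {v}. M *\<^sub>R w)"
    have Mgt: "\<bar>coord B w v'\<bar> < M" if "w \<in> B - {v}" for w
      using member_le_sum[of w "B - {v}" "\<lambda>w. \<bar>coord B w v'\<bar>"] that fin unfolding M_def by auto
    have M0: "M > 0" unfolding M_def by (intro add_nonneg_pos sum_nonneg) auto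
    have s0: "coord B u (\<Sum>w\<in>B - {v}. M *\<^sub>R w) = (if u = v then 0 else M)" if "u \<in> B" for u
    proof -
      have "coord B u (\<Sum>w\<in>B - {v}. M *\<^sub>R w) = (\<Sum>w\<in>B - {v}. if w = u then M else 0)"
        using assms by (simp add: coord_sum coord_scale) (intro sum.cong, auto simp: coord_basis)
      then show ?thesis using that fin by auto
    qed
    have posB: "0 < coord B u y" if "u \<in> B" for u
      using that Mgt[of u] assms l1 unfolding y_def
      by (cases "u = v") (auto simp: coord_add s0 l_def)
    have "coord ?C u y > 0" if "u \<in> ?C" for u
    proof (cases "u = v'")
      case True
      then show ?thesis using l[of y] posB[OF assms(2)] l1 by simp
    next
      case False
      then have u: "u \<in> B - {v}" using that by auto
      have "coord ?C v' y = 1" using l[of y] l1 assms unfolding y_def by (simp add: coord_add s0 l_def)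
      then show ?thesis using coordw[OF u, of y] u assms M0 unfolding y_def by (simp add: coord_add s0)
    qed
    then have "B = ?C" using open_cones_disjoint[OF assms(1,4), of y] posB by blast
    then show False using assms by auto
  qed
  ultimately have lm: "l = - 1" by simp
  then show "coord B v v' = - 1" by (simp add: l_def)
  show e: "coord ?C v' z = - coord B v z" for z using l[of z] lm by simp
  show "coord ?C w z = coord B w z + coord B w v' * coord B v z" if "w \<in> B - {v}"
    using coordw[OF that, of z] e[of z] by simp
qed

lemma neighbour_unique:
  assumes "B \<in> \<B>" "v \<in> B" "v1 \<notin> B" "insert v1 (B - {v}) \<in> \<B>" "v2 \<notin> B" "insert v2 (B - {v}) \<in> \<B>"
  shows "v1 = v2"
proof -
  have fin: "finite B" using assms finite_B by blast
  define M where "M = (\<Sum>w\<in>B - {v}. \<bar>coord B w v1\<bar> + \<bar>coord B w v2\<bar>) + 1"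
  \<comment> \<open>This point lies across the ridge, with \<open>v\<close>-coordinate
    \<open>- 1\<close>. In either neighbouring basis its coordinate at \<open>w\<close> is
    \<open>M\<close> minus the coordinate of the new vertex, so both open cones contain it.\<close>
  define y where "y = (\<Sum>w\<in>B. (if w = v then - 1 else M) *\<^sub>R w)"
  have Mgt: "\<bar>coord B w v1\<bar> + \<bar>coord B w v2\<bar> < M" if "w \<in> B - {v}" for w
    using member_le_sum[of w "B - {v}" "\<lambda>w. \<bar>coord B w v1\<bar> + \<bar>coord B w v2\<bar>"] that fin unfolding M_def by auto
  have y: "coord B u y = (if u = v then - 1 else M)" if "u \<in> B" for u
    using assms that unfolding y_def by (simp add: coord_lincomb)
  have 1: "0 < coord (insert v1 (B - {v})) u y" if "u \<in> insert v1 (B - {v})" for u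
  proof (cases "u = v1")
    case True
    then show ?thesis using coord_exchange(2)[OF assms(1-4)] y[of v] assms by simp
  next
    case False
    then show ?thesis using coord_exchange(3)[OF assms(1-4), of u y] y[of v] y[of u] Mgt[of u] that assms by auto
  qed
  have 2: "0 < coord (insert v2 (B - {v})) u y" if "u \<in> insert v2 (B - {v})" for u
  proof (cases "u = v2")
    case True
    then show ?thesis using coord_exchange(2)[OF assms(1,2,5,6)] y[of v] assms by simp
  next
    case False
    then show ?thesis using coord_exchange(3)[OF assms(1,2,5,6), of u y] y[of v] y[of u] Mgt[of u] that assms by auto
  qed
  have "insert v1 (B - {v}) = insert v2 (B - {v})"
    using open_cones_disjoint[OF assms(4,6), of y] 1 2 by blast
  then show ?thesis using assms by auto
qed

text \<open>The vertex of the adjacent facet across the ridge \<open>B - {v}\<close>; the adjacent facet is \<open>flip B v\<close>.\<close>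

definition opp :: "(real ^ 'n) set \<Rightarrow> real ^ 'n \<Rightarrow> real ^ 'n" where
  "opp B v = (THE v'. v' \<notin> B \<and> insert v' (B - {v}) \<in> \<B>)"

definition flip :: "(real ^ 'n) set \<Rightarrow> real ^ 'n \<Rightarrow> (real ^ 'n) set" where
  "flip B v = insert (opp B v) (B - {v})"

lemma opp: 
  assumes "B \<in> \<B>" "v \<in> B" shows "opp B v \<notin> B" "flip B v \<in> \<B>"
proof -
  have "opp B v \<notin> B \<and> insert (opp B v) (B - {v}) \<in> \<B>"
    unfolding opp_def
  proof (rule theI')
    show "\<exists>!v'. v' \<notin> B \<and> insert v' (B - {v}) \<in> \<B>"
      using neighbour_exists[OF assms] neighbour_unique[OF assms] by (elim exE) (rule ex1I, auto)
  qed
  then show "opp B v \<notin> B" "flip B v \<in> \<B>" by (auto simp: flip_def)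
qed

lemma opp_eqI: "B \<in> \<B> \<Longrightarrow> v \<in> B \<Longrightarrow> v' \<notin> B \<Longrightarrow> insert v' (B - {v}) \<in> \<B> \<Longrightarrow> opp B v = v'"
  by (rule neighbour_unique[of B v]) (auto simp: opp opp(2)[unfolded flip_def])

lemma flip_minus: "B \<in> \<B> \<Longrightarrow> v \<in> B \<Longrightarrow> flip B v - {opp B v} = B - {v}"
  using opp(1) by (auto simp: flip_def)

lemma opp_flip:
  assumes "B \<in> \<B>" "v \<in> B"
  shows "opp (flip B v) (opp B v) = v" "flip (flip B v) (opp B v) = B"
proof -
  have B: "insert v (flip B v - {opp B v}) = B" using flip_minus[OF assms] assms by auto
  show 1: "opp (flip B v) (opp B v) = v"
  proof (rule opp_eqI)
    show "flip B v \<in> \<B>" "opp B v \<in> flip B v" using opp(2)[OF assms] by (simp_all add: flip_def)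
    show "v \<notin> flip B v" using opp(1)[OF assms] assms(2) by (auto simp: flip_def)
    show "insert v (flip B v - {opp B v}) \<in> \<B>" using assms(1) by (simp only: B)
  qed
  show "flip (flip B v) (opp B v) = B" unfolding flip_def[of "flip B v"] 1 using B .
qed

lemma coord_opp: "B \<in> \<B> \<Longrightarrow> v \<in> B \<Longrightarrow> coord B v (opp B v) = - 1"
  by (rule coord_exchange(1)) (auto simp: opp opp(2)[unfolded flip_def])

lemma coord_flip_opp: "B \<in> \<B> \<Longrightarrow> v \<in> B \<Longrightarrow> coord (flip B v) (opp B v) z = - coord B v z"
  unfolding flip_def by (rule coord_exchange(2)) (auto simp: opp opp(2)[unfolded flip_def])

lemma coord_flip: 
  "B \<in> \<B> \<Longrightarrow> v \<in> B \<Longrightarrow> w \<in> B - {v} \<Longrightarrow> 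
   coord (flip B v) w z = coord B w z + coord B w (opp B v) * coord B v z"
  unfolding flip_def by (rule coord_exchange(3)) (auto simp: opp opp(2)[unfolded flip_def])

definition flags :: "((real ^ 'n) set \<times> (real ^ 'n)) set" where
  "flags = (SIGMA B:\<B>. B)"

lemma sum_flags: "(\<Sum>B\<in>\<B>. \<Sum>v\<in>B. g B v) = (\<Sum>(B, v)\<in>flags. g B v)"
  unfolding flags_def using finite_cones finite_B by (simp add: sum.Sigma)

text \<open>Crossing the ridge is an involution on flags by \<open>opp_flip\<close>, so it only
  permutes the summands.\<close>

lemma sum_flip:
  "(\<Sum>B\<in>\<B>. \<Sum>v\<in>B. g B v) = (\<Sum>B\<in>\<B>. \<Sum>v\<in>B. (g (flip B v) (opp B v) :: real))"
proof -
  have "flip B v \<in> \<B> \<and> opp B v \<in> flip B v" if "B \<in> \<B>" "v \<in> B" for B v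
    using opp(2)[OF that] by (simp add: flip_def)
  then have "(\<Sum>p\<in>flags. (\<lambda>(B, v). g B v) p) = (\<Sum>p\<in>flags. (\<lambda>(B, v). g (flip B v) (opp B v)) p)"
    by (intro sum.reindex_bij_witness[where i = "\<lambda>(B, v). (flip B v, opp B v)" 
          and j = "\<lambda>(B, v). (flip B v, opp B v)"])
      (auto simp: flags_def opp_flip)
  then show ?thesis by (simp add: sum_flags)
qed

end

section \<open>Half-open decomposition and the h-vector\<close>

lemma lattice_add: "x \<in> integer_lattice \<Longrightarrow> y \<in> integer_lattice \<Longrightarrow> x + y \<in> integer_lattice"
  by (simp add: integer_lattice_def)

lemma lattice_scale: "k \<in> \<int> \<Longrightarrow> y \<in> integer_lattice \<Longrightarrow> k *\<^sub>R y \<in> integer_lattice"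
  by (simp add: integer_lattice_def)

lemma lattice_sum: "(\<And>i. i \<in> I \<Longrightarrow> f i \<in> integer_lattice) \<Longrightarrow> (\<Sum>i\<in>I. f i) \<in> integer_lattice"
  by (simp add: integer_lattice_def Ints_sum)

text \<open>In the induction, fixing the value \<open>j\<close> at the new index leaves vectors with
  sum at most \<open>k - j\<close>; the hockey-stick identity adds up their numbers.\<close>

lemma card_bounded_sum:
  assumes "finite S"
  shows "finite {c \<in> S \<rightarrow>\<^sub>E (UNIV :: nat set). sum c S \<le> k}
    \<and> card {c \<in> S \<rightarrow>\<^sub>E (UNIV :: nat set). sum c S \<le> k} = (k + card S) choose card S"
  using assms
proof (induction S arbitrary: k)
  case empty
  have "{c \<in> {} \<rightarrow>\<^sub>E (UNIV :: nat set). sum c {} \<le> k} = {\<lambda>_. undefined}" by auto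
  then show ?case by simp
next
  case (insert a S)
  let ?C = "\<lambda>S k. {c \<in> S \<rightarrow>\<^sub>E (UNIV :: nat set). sum c S \<le> k}"
  have bij: "bij_betw (\<lambda>(j, c). c(a := j)) (SIGMA j:{..k}. ?C S (k - j)) (?C (insert a S) k)"
  proof (rule bij_betw_byWitness[where f' = "\<lambda>c. (c a, restrict c S)"])
    show "\<forall>p\<in>SIGMA j:{..k}. ?C S (k - j). (\<lambda>c. (c a, restrict c S)) ((\<lambda>(j, c). c(a := j)) p) = p"
      using insert.hyps by (auto simp: fun_eq_iff PiE_def extensional_def)
    show "\<forall>c\<in>?C (insert a S) k. (\<lambda>(j, c). c(a := j)) ((\<lambda>c. (c a, restrict c S)) c) = c"
      by (auto simp: fun_eq_iff PiE_def extensional_def)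
    have "sum (c(a := j)) S = sum c S" for c :: "'a \<Rightarrow> nat" and j
      using insert.hyps by (intro sum.cong) auto
    then show "(\<lambda>(j, c). c(a := j)) ` (SIGMA j:{..k}. ?C S (k - j)) \<subseteq> ?C (insert a S) k"
      using insert.hyps by (auto simp: PiE_def extensional_def)
    have "sum (restrict c S) S = sum c S" for c :: "'a \<Rightarrow> nat"
      by (intro sum.cong) auto
    then show "(\<lambda>c. (c a, restrict c S)) ` ?C (insert a S) k \<subseteq> (SIGMA j:{..k}. ?C S (k - j))"
      using insert.hyps by auto
  qed
  have "card (?C (insert a S) k) = card (SIGMA j:{..k}. ?C S (k - j))"
    using bij_betw_same_card[OF bij] by simp
  also have "\<dots> = (\<Sum>j\<le>k. (k - j + card S) choose card S)"
    using insert.IH by (subst card_SigmaI) auto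
  also have "\<dots> = (\<Sum>j\<le>k. (card S + j) choose card S)"
    by (rule sum.reindex_bij_witness[where i = "\<lambda>j. k - j" and j = "\<lambda>j. k - j"]) (auto simp: add.commute)
  also have "\<dots> = (k + card (insert a S)) choose card (insert a S)"
    using insert.hyps choose_rising_sum(1)[of "card S" k] by (simp add: add.commute)
  finally have "card (?C (insert a S) k) = (k + card (insert a S)) choose card (insert a S)" .
  moreover have "finite (?C (insert a S) k)"
    using bij_betw_finite[OF bij] insert.IH by auto
  ultimately show ?case by blast
qed

context smooth_fano
begin

text \<open>A point lies in the half-open cone iff moving it slightly in direction \<open>x\<close> leads into the
  interior of the cone.\<close>

definition off_walls :: "real ^ 'n \<Rightarrow> bool" where
  "off_walls x \<longleftrightarrow> (\<forall>B\<in>\<B>. \<forall>v\<in>B. coord B v x \<noteq> 0)"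

definition half_open :: "(real ^ 'n) set \<Rightarrow> real ^ 'n \<Rightarrow> real ^ 'n \<Rightarrow> bool" where
  "half_open B x y \<longleftrightarrow> (\<forall>v\<in>B. 0 \<le> coord B v y \<and> (coord B v x < 0 \<longrightarrow> 0 < coord B v y))"

definition neg :: "(real ^ 'n) set \<Rightarrow> real ^ 'n \<Rightarrow> nat" where
  "neg B x = card {v \<in> B. coord B v x < 0}"

text \<open>These are the lattice points of the \<open>m\<close>-th dilate, described through the
  cones alone; \<open>ehrhart_count_eq\<close> makes the link to the polytope.\<close>

definition lattice_points :: "nat \<Rightarrow> (real ^ 'n) set" where
  "lattice_points m = {y \<in> integer_lattice. \<exists>B\<in>\<B>. (\<forall>v\<in>B. 0 \<le> coord B v y) \<and> ht B y \<le> real m}"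

lemma half_open_exists:
  assumes "off_walls x" shows "\<exists>B\<in>\<B>. half_open B x y"
proof -
  obtain C where "C \<in> \<B>" "\<And>u. u \<in> C \<Longrightarrow> 0 \<le> coord C u y"
    "\<And>u. u \<in> C \<Longrightarrow> coord C u y = 0 \<Longrightarrow> 0 \<le> coord C u x" by (rule covering_germ[of y x]) blast
  then show ?thesis
    using assms unfolding half_open_def off_walls_def by (meson less_eq_real_def not_le)
qed

lemma half_open_perturb:
  assumes "off_walls x" "B \<in> \<B>" "half_open B x y"
  shows "eventually (\<lambda>e. \<forall>v\<in>B. 0 < coord B v (y + e *\<^sub>R x)) (at_right 0)"
proof (rule eventually_ball_finite)
  show "\<forall>v\<in>B. eventually (\<lambda>e. 0 < coord B v (y + e *\<^sub>R x)) (at_right 0)"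
  proof
    fix v assume v: "v \<in> B"
    then consider "0 < coord B v y" | "coord B v y = 0" "0 < coord B v x"
      using assms unfolding half_open_def off_walls_def
      by (cases "coord B v y = 0") (force simp: less_le)+
    then show "eventually (\<lambda>e. 0 < coord B v (y + e *\<^sub>R x)) (at_right 0)"
    proof cases
      case 1
      have "((\<lambda>e. coord B v y + e * coord B v x) \<longlongrightarrow> coord B v y + 0 * coord B v x) (at_right 0)"
        by (intro tendsto_intros)
      then show ?thesis using 1 assms(2) by (auto dest: order_tendstoD(1) simp: coord_add coord_scale)
    next
      case 2
      then show ?thesis using eventually_at_right_less[of "0::real"] assms(2)
        by (auto elim!: eventually_mono simp: coord_add coord_scale)
    qed
  qed
qed (use assms finite_B in blast)

lemma half_open_unique:
  assumes "off_walls x" "B \<in> \<B>" "C \<in> \<B>" "half_open B x y" "half_open C x y"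
  shows "B = C"
proof -
  have "eventually (\<lambda>e. (\<forall>v\<in>B. 0 < coord B v (y + e *\<^sub>R x)) \<and> (\<forall>v\<in>C. 0 < coord C v (y + e *\<^sub>R x))) (at_right (0::real))"
    by (intro eventually_conj half_open_perturb assms)
  then obtain e where "\<forall>v\<in>B. 0 < coord B v (y + e *\<^sub>R x)" "\<forall>v\<in>C. 0 < coord C v (y + e *\<^sub>R x)"
    using eventually_happens'[OF trivial_limit_at_right_real] by blast
  then show ?thesis using open_cones_disjoint assms by blast
qed

text \<open>Removing one copy of each vertex at which \<open>x\<close> is negative turns the strict
  conditions into nonstrict ones and lowers the height by \<open>neg B x\<close>. This leaves
  arbitrary vectors of natural numbers with sum at most \<open>m - neg B x\<close>; \<open>t\<close>
  is the shift.\<close>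

lemma card_half_open:
  fixes x :: "real ^ 'n" and m :: nat
  assumes B: "B \<in> \<B>"
  defines "S \<equiv> {y \<in> integer_lattice. half_open B x y \<and> ht B y \<le> real m}"
  shows "finite S \<and> card S = (m + CARD('n) - neg B x) choose CARD('n)"
proof -
  define t :: "real ^ 'n \<Rightarrow> nat" where "t v = (if coord B v x < 0 then 1 else 0)" for v
  have fin: "finite B" using B finite_B by blast
  have t: "(\<Sum>v\<in>B. t v) = neg B x"
    using fin unfolding t_def neg_def by (simp add: sum.If_cases Int_def)
  have cS: "\<exists>k. coord B v y = real k \<and> t v \<le> k" if "y \<in> S" "v \<in> B" for y v
  proof -
    have "coord B v y \<in> \<int>" "0 \<le> coord B v y" "coord B v x < 0 \<longrightarrow> 0 < coord B v y"
      using that B coord_Ints unfolding S_def half_open_def by auto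
    then obtain k :: nat where "coord B v y = real k"
      by (metis Ints_cases int_nat_eq of_int_of_nat_eq of_int_0_le_iff)
    then show ?thesis using \<open>coord B v x < 0 \<longrightarrow> 0 < coord B v y\<close> by (auto simp: t_def)
  qed
  show ?thesis
  proof (cases "neg B x \<le> m")
    case False
    have "S = {}"
    proof (rule equals0I)
      fix y assume y: "y \<in> S"
      have "real (neg B x) = (\<Sum>v\<in>B. real (t v))" by (simp flip: t)
      also have "\<dots> \<le> ht B y" unfolding ht_def using cS[OF y] by (intro sum_mono) force
      finally show False using y False unfolding S_def by simp
    qed
    \<comment> \<open>The binomial coefficient therefore vanishes. Positivity of the dimension
      covers a truncated subtraction.\<close>
    moreover have "m + CARD('n) - neg B x < CARD('n)"
      using False zero_less_card_finite[where 'a = 'n] by linarith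
    ultimately show ?thesis by simp
  next
    case True
    let ?C = "{c \<in> B \<rightarrow>\<^sub>E (UNIV :: nat set). sum c B \<le> m - neg B x}"
    have bij: "bij_betw (\<lambda>c. \<Sum>v\<in>B. real (c v + t v) *\<^sub>R v) ?C S"
    proof (rule bij_betw_byWitness[where f' = "\<lambda>y. restrict (\<lambda>v. nat \<lfloor>coord B v y\<rfloor> - t v) B"])
      show "\<forall>c\<in>?C. restrict (\<lambda>v. nat \<lfloor>coord B v (\<Sum>v\<in>B. real (c v + t v) *\<^sub>R v)\<rfloor> - t v) B = c"
        using B by (auto simp: fun_eq_iff coord_lincomb PiE_def extensional_def simp del: of_nat_add)
      show "\<forall>y\<in>S. (\<Sum>v\<in>B. real (restrict (\<lambda>v. nat \<lfloor>coord B v y\<rfloor> - t v) B v + t v) *\<^sub>R v) = y"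
      proof
        fix y assume y: "y \<in> S"
        have "(\<Sum>v\<in>B. real (restrict (\<lambda>v. nat \<lfloor>coord B v y\<rfloor> - t v) B v + t v) *\<^sub>R v) = (\<Sum>v\<in>B. coord B v y *\<^sub>R v)"
          using cS[OF y] by (intro sum.cong) force+
        then show "(\<Sum>v\<in>B. real (restrict (\<lambda>v. nat \<lfloor>coord B v y\<rfloor> - t v) B v + t v) *\<^sub>R v) = y"
          using coord_expand[OF B] by simp
      qed
      show "(\<lambda>c. \<Sum>v\<in>B. real (c v + t v) *\<^sub>R v) ` ?C \<subseteq> S"
      proof (clarify)
        fix c assume c: "sum c B \<le> m - neg B x"
        let ?y = "\<Sum>v\<in>B. real (c v + t v) *\<^sub>R v"
        have "?y \<in> integer_lattice"
          using vertices_lattice[OF B] by (intro lattice_sum lattice_scale) auto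
        moreover have "half_open B x ?y"
          using B unfolding half_open_def by (auto simp: coord_lincomb t_def simp del: of_nat_add)
        moreover have "ht B ?y = real (sum c B + neg B x)"
          using B unfolding ht_def by (simp add: coord_lincomb sum.distrib flip: t)
        then have "ht B ?y \<le> real m" using c True by (simp only: of_nat_le_iff)
        ultimately show "?y \<in> S" unfolding S_def by blast
      qed
      show "(\<lambda>y. restrict (\<lambda>v. nat \<lfloor>coord B v y\<rfloor> - t v) B) ` S \<subseteq> ?C"
      proof (clarify, intro conjI)
        fix y assume y: "y \<in> S"
        have "real (\<Sum>v\<in>B. nat \<lfloor>coord B v y\<rfloor> - t v) + real (neg B x) = (\<Sum>v\<in>B. real (nat \<lfloor>coord B v y\<rfloor> - t v + t v))"
          by (simp add: sum.distrib flip: t)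
        also have "\<dots> = ht B y"
          unfolding ht_def using cS[OF y] by (intro sum.cong) force+
        also have "\<dots> \<le> real m" using y unfolding S_def by simp
        finally have "(\<Sum>v\<in>B. nat \<lfloor>coord B v y\<rfloor> - t v) + neg B x \<le> m" by linarith
        then show "sum (restrict (\<lambda>v. nat \<lfloor>coord B v y\<rfloor> - t v) B) B \<le> m - neg B x" by simp
      qed auto
    qed
    have "m - neg B x + card B = m + CARD('n) - neg B x" using True card_B[OF B] by simp
    then show ?thesis
      using card_bounded_sum[OF fin, of "m - neg B x"] bij_betw_same_card[OF bij] bij_betw_finite[OF bij] card_B[OF B]
      by simp
  qed
qed

text \<open>The half-open cones partition the space, and by \<open>ht_max\<close> passing from a
  closed cone containing \<open>y\<close> to the half-open one does not raise the height.\<close>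

lemma card_lattice_points:
  assumes "off_walls x"
  shows "finite (lattice_points m)" 
    and "card (lattice_points m) = (\<Sum>B\<in>\<B>. (m + CARD('n) - neg B x) choose CARD('n))"
proof -
  let ?S = "\<lambda>B. {y \<in> integer_lattice. half_open B x y \<and> ht B y \<le> real m}"
  have eq: "lattice_points m = (\<Union>B\<in>\<B>. ?S B)"
  proof (intro equalityI subsetI)
    fix y assume "y \<in> lattice_points m"
    then obtain C where C: "C \<in> \<B>" "\<And>v. v \<in> C \<Longrightarrow> 0 \<le> coord C v y" "ht C y \<le> real m" "y \<in> integer_lattice"
      unfolding lattice_points_def by auto
    obtain B where B: "B \<in> \<B>" "half_open B x y" using half_open_exists[OF assms] by auto
    then have "ht B y \<le> ht C y" using C by (intro ht_max)
    then show "y \<in> (\<Union>B\<in>\<B>. ?S B)" using B C by auto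
  next
    fix y assume "y \<in> (\<Union>B\<in>\<B>. ?S B)"
    then show "y \<in> lattice_points m" unfolding lattice_points_def half_open_def by auto
  qed
  show "finite (lattice_points m)" unfolding eq using finite_cones card_half_open by auto
  have "card (\<Union>B\<in>\<B>. ?S B) = (\<Sum>B\<in>\<B>. card (?S B))"
  proof (rule card_UN_disjoint)
    show "\<forall>B\<in>\<B>. \<forall>C\<in>\<B>. B \<noteq> C \<longrightarrow> ?S B \<inter> ?S C = {}" using half_open_unique[OF assms] by blast
  qed (use finite_cones card_half_open in auto)
  then show "card (lattice_points m) = (\<Sum>B\<in>\<B>. (m + CARD('n) - neg B x) choose CARD('n))"
    unfolding eq using card_half_open by simp
qed

lemma neg_le: "B \<in> \<B> \<Longrightarrow> neg B x \<le> CARD('n)"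
  unfolding neg_def using card_mono[OF finite_B] card_B by (metis (no_types, lifting) mem_Collect_eq subsetI)

definition hvec :: "real ^ 'n \<Rightarrow> nat \<Rightarrow> nat" where
  "hvec x i = card {B \<in> \<B>. neg B x = i}"

lemma sum_neg: "(\<Sum>B\<in>\<B>. g (neg B x)) = (\<Sum>i\<le>CARD('n). of_nat (hvec x i) * (g i :: 'c :: comm_semiring_1))"
proof -
  have "(\<Sum>B\<in>\<B>. g (neg B x)) = (\<Sum>i\<le>CARD('n). \<Sum>B | B \<in> \<B> \<and> neg B x = i. g (neg B x))"
    using finite_cones neg_le by (intro sum.group[symmetric]) auto
  also have "\<dots> = (\<Sum>i\<le>CARD('n). of_nat (hvec x i) * g i)"
    unfolding hvec_def by (intro sum.cong) auto
  finally show ?thesis .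
qed

lemma card_lattice_points_hvec:
  assumes "off_walls x"
  shows "card (lattice_points m) = (\<Sum>i\<le>CARD('n). hvec x i * ((m + CARD('n) - i) choose CARD('n)))"
  using sum_neg[where g = "\<lambda>i. (m + CARD('n) - i) choose CARD('n)"] card_lattice_points(2)[OF assms] by simp

text \<open>The counts at \<open>m = 0, 1, ...\<close> form a unitriangular system for the
  \<open>hvec x i\<close>, while the counts themselves do not involve \<open>x\<close>.\<close>

lemma hvec_unique:
  assumes "off_walls x" "off_walls y" "i \<le> CARD('n)" shows "hvec x i = hvec y i"
  using assms(3)
proof (induction i rule: less_induct)
  case (less i)
  let ?d = "CARD('n)"
  have L: "card (lattice_points i) = (\<Sum>j<i. hvec z j * ((i + ?d - j) choose ?d)) + hvec z i" if "off_walls z" for z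
  proof -
    have "card (lattice_points i) = (\<Sum>j\<le>?d. hvec z j * ((i + ?d - j) choose ?d))"
      by (rule card_lattice_points_hvec[OF that])
    also have "\<dots> = (\<Sum>j\<le>i. hvec z j * ((i + ?d - j) choose ?d))"
      using less.prems by (intro sum.mono_neutral_right) (auto simp: not_le intro!: binomial_eq_0)
    finally show ?thesis by (simp add: lessThan_Suc_atMost[symmetric])
  qed
  have "(\<Sum>j<i. hvec x j * ((i + ?d - j) choose ?d)) = (\<Sum>j<i. hvec y j * ((i + ?d - j) choose ?d))"
    using less by (intro sum.cong) auto
  then show ?case using L[OF assms(1)] L[OF assms(2)] by simp
qed

lemma off_walls_uminus: "off_walls (- x) \<longleftrightarrow> off_walls x"
  unfolding off_walls_def by (auto simp: coord_neg)

lemma neg_uminus: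
  assumes "off_walls x" "B \<in> \<B>" shows "neg B (- x) = CARD('n) - neg B x"
proof -
  have "{v \<in> B. coord B v (- x) < 0} = B - {v \<in> B. coord B v x < 0}"
    using assms unfolding off_walls_def by (force simp: coord_neg)
  then show ?thesis unfolding neg_def using finite_B card_B assms(2)
    by (metis (no_types, lifting) card_Diff_subset finite_subset mem_Collect_eq subsetI)
qed

text \<open>Replacing \<open>x\<close> by \<open>- x\<close> flips the sign of every coordinate, and
  by \<open>hvec_unique\<close> does not change the vector.\<close>

lemma hvec_symmetric:
  assumes "off_walls x" "i \<le> CARD('n)" shows "hvec x (CARD('n) - i) = hvec x i"
proof -
  have "hvec x (CARD('n) - i) = hvec (- x) i"
    unfolding hvec_def using assms neg_uminus[OF assms(1)] neg_le
    by (intro arg_cong[where f = card] Collect_cong) (metis diff_diff_cancel)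
  then show ?thesis using hvec_unique[of "- x" x i] assms off_walls_uminus by simp
qed

text \<open>A cone without negative coordinates has \<open>x\<close> in its interior, and only one
  cone does.\<close>

lemma hvec_0: 
  assumes "off_walls x" shows "hvec x 0 = 1"
proof -
  have "neg B x = 0 \<longleftrightarrow> (\<forall>v\<in>B. 0 < coord B v x)" if "B \<in> \<B>" for B
  proof -
    have "neg B x = 0 \<longleftrightarrow> (\<forall>v\<in>B. \<not> coord B v x < 0)"
      unfolding neg_def using finite_B[OF that] by auto
    also have "\<dots> \<longleftrightarrow> (\<forall>v\<in>B. 0 < coord B v x)"
      using assms that unfolding off_walls_def by (metis linorder_neqE not_less_iff_gr_or_eq)
    finally show ?thesis .
  qed
  then have "{B \<in> \<B>. neg B x = 0} = {B \<in> \<B>. \<forall>v\<in>B. 0 < coord B v x}" by blast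
  moreover obtain B where B: "B \<in> \<B>" "\<And>v. v \<in> B \<Longrightarrow> 0 \<le> coord B v x" using covering by blast
  then have "\<forall>v\<in>B. 0 < coord B v x" using assms unfolding off_walls_def by (simp add: less_le)
  then have "{B \<in> \<B>. \<forall>v\<in>B. 0 < coord B v x} = {B}" using open_cones_disjoint B by blast
  ultimately show ?thesis unfolding hvec_def by simp
qed

end

section \<open>The sum of the intersection numbers\<close>

text \<open>Taking the mean of floor and ceiling makes \<open>mid\<close> and \<open>saw\<close> odd also at integers, which is what the
  pairing of adjacent facets needs.\<close>

definition mid :: "real \<Rightarrow> real" where
  "mid a = (of_int \<lfloor>a\<rfloor> + of_int \<lceil>a\<rceil>) / 2"

definition saw :: "real \<Rightarrow> real" where
  "saw a = a - mid a"

lemma mid_minus: "mid (- a) = - mid a"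
  unfolding mid_def by (simp add: ceiling_def field_simps)

lemma mid_add_Ints: "m \<in> \<int> \<Longrightarrow> mid (a + m) = mid a + m"
  unfolding mid_def by (auto elim!: Ints_cases simp: field_simps)

lemma mid_Ints: "a \<in> \<int> \<Longrightarrow> mid a = a"
  unfolding mid_def by (auto elim!: Ints_cases)

lemma saw_add_Ints: "m \<in> \<int> \<Longrightarrow> saw (a + m) = saw a"
  by (simp add: saw_def mid_add_Ints)

lemma ceiling_notin_Ints: "a \<notin> \<int> \<Longrightarrow> \<lceil>a\<rceil> = \<lfloor>a\<rfloor> + 1"
  by (metis Ints_of_int ceiling_altdef)

lemma mid_notin_Ints: "a \<notin> \<int> \<Longrightarrow> mid a = of_int \<lfloor>a\<rfloor> + 1 / 2"
  by (simp add: mid_def ceiling_notin_Ints)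

lemma floor_times_ceiling: "a \<notin> \<int> \<Longrightarrow> of_int (\<lfloor>a\<rfloor> * \<lceil>a\<rceil>) = (mid a)\<^sup>2 - 1 / 4"
  by (simp add: mid_notin_Ints ceiling_notin_Ints power2_eq_square field_simps)

text \<open>This is Hermite's identity for the floor function: each of the three \<open>mid\<close>
  terms exceeds its floor by 1/2.\<close>

lemma mid_half:
  assumes "2 * a \<notin> \<int>" shows "mid a + mid (a + 1 / 2) = mid (2 * a) + 1 / 2"
proof -
  have 1: "a \<notin> \<int>" using assms by auto
  have 2: "a + 1 / 2 \<notin> \<int>"
  proof
    assume "a + 1 / 2 \<in> \<int>"
    then have "2 * (a + 1 / 2) - 1 \<in> \<int>" by (intro Ints_diff Ints_mult) auto
    then show False using assms by simp
  qed
  obtain k where k: "\<lfloor>a\<rfloor> = k" "of_int k \<le> a" "a < of_int k + 1"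
    by (rule that[OF refl]) linarith+
  have "\<lfloor>2 * a\<rfloor> = \<lfloor>a\<rfloor> + \<lfloor>a + 1 / 2\<rfloor>"
  proof (cases "a < of_int k + 1 / 2")
    case True
    then have "\<lfloor>2 * a\<rfloor> = 2 * k" "\<lfloor>a + 1 / 2\<rfloor> = k" using k(2,3) by (simp_all add: floor_eq_iff)
    then show ?thesis using k(1) by simp
  next
    case False
    then have "\<lfloor>2 * a\<rfloor> = 2 * k + 1" "\<lfloor>a + 1 / 2\<rfloor> = k + 1" using k(2,3) by (simp_all add: floor_eq_iff)
    then show ?thesis using k(1) by simp
  qed
  then show ?thesis using mid_notin_Ints 1 2 assms by simp
qed

lemma saw_half:
  assumes "2 * a \<notin> \<int>" shows "saw a + saw (a + 1 / 2) = saw (2 * a)"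
  using mid_half[OF assms] by (simp add: saw_def)

lemma saw_half_eq:
  assumes "2 * a \<notin> \<int>" shows "saw (a + 1 / 2) = saw a + 1 / 2 \<or> saw (a + 1 / 2) = saw a - 1 / 2"
proof -
  have 1: "a \<notin> \<int>" using assms by auto
  have 2: "a + 1 / 2 \<notin> \<int>"
  proof
    assume "a + 1 / 2 \<in> \<int>"
    then have "2 * (a + 1 / 2) - 1 \<in> \<int>" by (intro Ints_diff Ints_mult) auto
    then show False using assms by simp
  qed
  have "\<lfloor>a + 1 / 2\<rfloor> = \<lfloor>a\<rfloor> \<or> \<lfloor>a + 1 / 2\<rfloor> = \<lfloor>a\<rfloor> + 1" by linarith
  then show ?thesis using mid_notin_Ints[OF 1] mid_notin_Ints[OF 2] by (auto simp: saw_def)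
qed

text \<open>For non-integral \<open>a\<close>, \<open>saw a\<close> is the fractional part minus
  1/2, so the square minus 1/12 is the second Bernoulli polynomial of the fractional part. The
  constant 1/12 is what makes its distribution relation hold.\<close>

lemma saw_square_half:
  assumes "2 * a \<notin> \<int>"
  shows "((saw a)\<^sup>2 - 1 / 12) + ((saw (a + 1 / 2))\<^sup>2 - 1 / 12) = ((saw (2 * a))\<^sup>2 - 1 / 12) / 2"
proof -
  define s where "s = saw (a + 1 / 2)"
  have "s = saw a + 1 / 2 \<or> s = saw a - 1 / 2" using saw_half_eq[OF assms] by (simp only: s_def)
  then show ?thesis unfolding saw_half[OF assms, symmetric] s_def[symmetric]
    by (elim disjE) (simp_all only:, simp_all add: power2_eq_square field_simps)
qed

text \<open>Near a non-integral \<open>a\<close> nothing changes. At an integer \<open>k\<close>, a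
  step to either side moves \<open>mid\<close> by plus or minus 1/2 and the product from
  \<open>k * k\<close> to \<open>k * (k + 1)\<close> or \<open>k * (k - 1)\<close>, so the linear
  term in the jump is exact.\<close>

lemma eventually_mid:
  "eventually (\<lambda>e. (mid (a + e * c) \<noteq> mid a \<longrightarrow> a \<in> \<int>) \<and>
     real_of_int (\<lfloor>a + e * c\<rfloor> * \<lceil>a + e * c\<rceil>) = of_int (\<lfloor>a\<rfloor> * \<lceil>a\<rceil>) + 2 * mid a * (mid (a + e * c) - mid a)) (at 0)"
proof -
  \<comment> \<open>The distance to the nearest integer, or 1 if \<open>a\<close> is an integer
    itself.\<close>
  define r where "r = (if a \<in> \<int> then 1 else min (a - of_int \<lfloor>a\<rfloor>) (of_int \<lceil>a\<rceil> - a))"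
  have "r > 0"
    unfolding r_def by (auto simp: ceiling_notin_Ints) (metis Ints_of_int floor_less_iff linorder_not_less of_int_floor_le order_le_less)
  have "((\<lambda>e. \<bar>e * c\<bar>) \<longlongrightarrow> \<bar>0 * c\<bar>) (at 0)" by (intro tendsto_intros)
  then have "eventually (\<lambda>e. \<bar>e * c\<bar> < r) (at 0)" using \<open>r > 0\<close> by (intro order_tendstoD(2)) auto
  then show ?thesis
  proof (rule eventually_mono)
    fix e assume e: "\<bar>e * c\<bar> < r"
    define d where "d = e * c"
    have d: "\<bar>d\<bar> < r" using e by (simp add: d_def)
    show "(mid (a + e * c) \<noteq> mid a \<longrightarrow> a \<in> \<int>) \<and>
       real_of_int (\<lfloor>a + e * c\<rfloor> * \<lceil>a + e * c\<rceil>) = of_int (\<lfloor>a\<rfloor> * \<lceil>a\<rceil>) + 2 * mid a * (mid (a + e * c) - mid a)"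
      unfolding d_def[symmetric]
    proof (cases "a \<in> \<int>")
      case False
      then have "\<lfloor>a + d\<rfloor> = \<lfloor>a\<rfloor>" "\<lceil>a + d\<rceil> = \<lceil>a\<rceil>"
        using d unfolding r_def by (auto simp: floor_eq_iff ceiling_eq_iff ceiling_notin_Ints abs_less_iff)
      then show "(mid (a + d) \<noteq> mid a \<longrightarrow> a \<in> \<int>) \<and>
         real_of_int (\<lfloor>a + d\<rfloor> * \<lceil>a + d\<rceil>) = of_int (\<lfloor>a\<rfloor> * \<lceil>a\<rceil>) + 2 * mid a * (mid (a + d) - mid a)"
        by (simp add: mid_def)
    next
      case True
      then obtain k :: int where k: "a = of_int k" by (auto elim: Ints_cases)
      have "\<bar>d\<bar> < 1" using d True unfolding r_def by simp
      then consider "d = 0" | "\<lfloor>d\<rfloor> = 0" "\<lceil>d\<rceil> = 1" | "\<lfloor>d\<rfloor> = - 1" "\<lceil>d\<rceil> = 0" by linarith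
      then show "(mid (a + d) \<noteq> mid a \<longrightarrow> a \<in> \<int>) \<and>
         real_of_int (\<lfloor>a + d\<rfloor> * \<lceil>a + d\<rceil>) = of_int (\<lfloor>a\<rfloor> * \<lceil>a\<rceil>) + 2 * mid a * (mid (a + d) - mid a)"
        by cases (auto simp: k mid_def algebra_simps)
    qed
  qed
qed

section \<open>Representatives of the lattice modulo two, and generic vectors\<close>

definition torsion :: "(real ^ 'n) set" where
  "torsion = {l. \<forall>i. l $ i \<in> {0, 1}}"

lemma finite_torsion: "finite torsion"
proof -
  have "torsion \<subseteq> (\<lambda>S. \<chi> i. (if i \<in> S then 1 else 0 :: real)) ` UNIV"
  proof
    fix l :: "real ^ 'n" assume "l \<in> torsion"
    then have "l = (\<chi> i. if i \<in> {i. l $ i = 1} then 1 else 0)"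
      unfolding torsion_def vec_eq_iff by auto
    then show "l \<in> (\<lambda>S. \<chi> i. (if i \<in> S then 1 else 0 :: real)) ` UNIV" by blast
  qed
  then show ?thesis by (rule finite_subset) simp
qed

lemma torsion_nonempty: "torsion \<noteq> {}"
  unfolding torsion_def by (auto intro!: exI[of _ 0])

lemma torsion_lattice: "torsion \<subseteq> integer_lattice"
proof
  fix l :: "real ^ 'n" assume "l \<in> torsion"
  then have "l $ i = 0 \<or> l $ i = 1" for i by (auto simp: torsion_def)
  then have "l $ i \<in> \<int>" for i by (metis Ints_0 Ints_1)
  then show "l \<in> integer_lattice" by (simp add: integer_lattice_def)
qed

text \<open>By periodicity \<open>g\<close> depends only on the class modulo two. Translation by
  \<open>u\<close> permutes these classes, and \<open>red\<close> returns to the chosen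
  representatives.\<close>

lemma sum_torsion_shift:
  fixes u :: "real ^ 'n"
  assumes u: "u \<in> integer_lattice"
    and per: "\<And>l k. l \<in> integer_lattice \<Longrightarrow> k \<in> integer_lattice \<Longrightarrow> g (l + 2 *\<^sub>R k) = (g l :: real)"
  shows "(\<Sum>l\<in>torsion. g (l + u)) = (\<Sum>l\<in>torsion. g l)"
proof -
  define red where "red l = ((\<chi> i. of_int (\<lfloor>l $ i\<rfloor> mod 2)) :: real ^ 'n)" for l :: "real ^ 'n"
  have red: "red l \<in> torsion" for l unfolding red_def torsion_def by auto
  have "g l = g (red l)" if "l \<in> integer_lattice" for l
  proof -
    define k :: "real ^ 'n" where "k = (\<chi> i. of_int (\<lfloor>l $ i\<rfloor> div 2))"
    have "l = red l + 2 *\<^sub>R k"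
    proof (simp add: vec_eq_iff red_def k_def, rule allI)
      fix i
      have "l $ i \<in> \<int>" using that by (simp add: integer_lattice_def)
      then obtain j where "l $ i = of_int j" by (auto elim: Ints_cases)
      moreover have "real_of_int j = of_int (j mod 2 + 2 * (j div 2))" by simp
      ultimately show "l $ i = real_of_int (\<lfloor>l $ i\<rfloor> mod 2) + 2 * real_of_int (\<lfloor>l $ i\<rfloor> div 2)"
        by (metis floor_of_int of_int_add of_int_mult of_int_numeral)
    qed
    moreover have "k \<in> integer_lattice" by (simp add: k_def integer_lattice_def)
    ultimately show ?thesis using per[of "red l" k] red torsion_lattice by (metis subsetD)
  qed
  then have "(\<Sum>l\<in>torsion. g (l + u)) = (\<Sum>l\<in>torsion. g (red (l + u)))"
    using u torsion_lattice by (intro sum.cong) (auto intro: lattice_add)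
  also have "\<dots> = (\<Sum>l\<in>torsion. g l)"
  proof (rule sum.reindex_bij_betw)
    have "inj_on (\<lambda>l. red (l + u)) torsion"
    proof (rule inj_onI)
      fix l l' assume l: "l \<in> torsion" "l' \<in> torsion" and eq: "red (l + u) = red (l' + u)"
      show "l = l'" unfolding vec_eq_iff
      proof
        fix i
        have "u $ i \<in> \<int>" using u by (simp add: integer_lattice_def)
        then obtain j where j: "u $ i = of_int j" by (auto elim: Ints_cases)
        have "\<lfloor>l $ i + of_int j\<rfloor> mod 2 = \<lfloor>l' $ i + of_int j\<rfloor> mod 2"
        proof -
          have "red (l + u) $ i = red (l' + u) $ i" using eq by simp
          then show ?thesis by (simp add: red_def j)
        qed
        moreover have "l $ i = 0 \<or> l $ i = 1" "l' $ i = 0 \<or> l' $ i = 1" using l unfolding torsion_def by auto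
        ultimately show "l $ i = l' $ i" by (elim disjE) (simp_all, presburger+)
      qed
    qed
    moreover have "(\<lambda>l. red (l + u)) ` torsion \<subseteq> torsion" using red by auto
    ultimately show "bij_betw (\<lambda>l. red (l + u)) torsion torsion"
      using endo_inj_surj[OF finite_torsion] unfolding bij_betw_def by blast
  qed
  finally show ?thesis .
qed

text \<open>Equivalently, 1 and the coordinates of \<open>x\<close> are linearly independent over
  the rationals. This avoids the integer translates of all rational hyperplanes at once, so it
  covers combinations of walls as well as walls.\<close>

definition generic :: "real ^ 'n \<Rightarrow> bool" where
  "generic x \<longleftrightarrow> (\<forall>f. linear f \<longrightarrow> (\<forall>y\<in>integer_lattice. f y \<in> \<int>) \<longrightarrow> (\<exists>y. f y \<noteq> 0) \<longrightarrow> f x \<notin> (\<int> :: real set))"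

text \<open>The vectors to avoid form a countable union of hyperplanes, one for each nonzero
  integral form and integer value, hence a null set.\<close>

lemma generic_exists: "\<exists>x :: real ^ 'n. generic x"
proof -
  define I where "I = {a :: real ^ 'n. a \<in> integer_lattice \<and> a \<noteq> 0} \<times> (\<int> :: real set)"
  have "countable (integer_lattice :: (real ^ 'n) set)"
  proof -
    have "(integer_lattice :: (real ^ 'n) set) \<subseteq> (\<lambda>f. \<chi> i. of_int (f i)) ` (UNIV :: ('n \<Rightarrow> int) set)"
    proof
      fix y :: "real ^ 'n" assume "y \<in> integer_lattice"
      then have "y = (\<chi> i. of_int \<lfloor>y $ i\<rfloor>)" unfolding integer_lattice_def vec_eq_iff by auto
      then show "y \<in> (\<lambda>f. \<chi> i. of_int (f i)) ` (UNIV :: ('n \<Rightarrow> int) set)"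
        by (intro image_eqI[where x = "\<lambda>i. \<lfloor>y $ i\<rfloor>"]) auto
    qed
    moreover have "countable (UNIV :: ('n \<Rightarrow> int) set)" by (rule countableI_type)
    ultimately show ?thesis by (meson countable_image countable_subset)
  qed
  moreover have "countable (\<int> :: real set)" unfolding Ints_def by simp
  ultimately have I: "countable I" unfolding I_def
    by (intro countable_SIGMA) (auto intro: countable_subset[of _ integer_lattice])
  have "negligible (\<Union>(a, b)\<in>I. {x. a \<bullet> x = b})"
    using I by (intro negligible_countable_Union countable_image) (auto simp: I_def intro!: negligible_hyperplane)
  then obtain x where x: "x \<notin> (\<Union>(a, b)\<in>I. {x. a \<bullet> x = b})"
    using non_negligible_UNIV by (metis UNIV_eq_I)
  have "f x \<notin> \<int>" if f: "linear f" "\<forall>y\<in>integer_lattice. f y \<in> \<int>" and y: "f y \<noteq> 0"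
    for f :: "real ^ 'n \<Rightarrow> real" and y
  proof
    assume fx: "f x \<in> \<int>"
    define a :: "real ^ 'n" where "a = (\<chi> i. f (axis i 1))"
    have a: "f z = a \<bullet> z" for z
    proof -
      have "f z = f (\<Sum>i\<in>UNIV. z $ i *\<^sub>R axis i 1)" using basis_expansion[of z] by (simp add: scalar_mult_eq_scaleR)
      also have "\<dots> = (\<Sum>i\<in>UNIV. z $ i * f (axis i 1))" by (simp add: linear_sum[OF f(1)] linear_cmul[OF f(1)])
      finally show ?thesis by (simp add: a_def inner_vec_def mult.commute)
    qed
    have "axis i 1 \<in> (integer_lattice :: (real ^ 'n) set)" for i by (auto simp: integer_lattice_def axis_def)
    then have "a \<in> integer_lattice" using f(2) by (simp add: a_def integer_lattice_def)
    moreover have "a \<noteq> 0" using y a by auto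
    ultimately show False using x fx a unfolding I_def by auto
  qed
  then show ?thesis unfolding generic_def by blast
qed

lemma generic_scale:
  fixes x :: "real ^ 'n"
  assumes "generic x" "k > 0" shows "generic (inverse (real k) *\<^sub>R x)"
  unfolding generic_def
proof (intro allI impI)
  fix f :: "real ^ 'n \<Rightarrow> real" assume f: "linear f" "\<forall>y\<in>integer_lattice. f y \<in> \<int>" "\<exists>y. f y \<noteq> 0"
  show "f (inverse (real k) *\<^sub>R x) \<notin> \<int>"
  proof
    assume "f (inverse (real k) *\<^sub>R x) \<in> \<int>"
    then have "real k * f (inverse (real k) *\<^sub>R x) \<in> \<int>" by (intro Ints_mult) auto
    then have "f x \<in> \<int>" using assms(2) by (simp add: linear_cmul[OF f(1)] mult.assoc[symmetric])
    then show False using assms(1) f unfolding generic_def by blast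
  qed
qed

lemma sum_offdiag_commute:
  fixes f g :: "'a \<Rightarrow> real"
  assumes "finite B"
  shows "(\<Sum>v\<in>B. f v * (\<Sum>w\<in>B - {v}. g w)) = (\<Sum>v\<in>B. g v * (\<Sum>w\<in>B - {v}. f w))"
proof -
  have "(\<Sum>v\<in>B. f v * (\<Sum>w\<in>B - {v}. g w)) = sum f B * sum g B - (\<Sum>v\<in>B. f v * g v)" for f g :: "'a \<Rightarrow> real"
  proof -
    have "(\<Sum>v\<in>B. f v * (\<Sum>w\<in>B - {v}. g w)) = (\<Sum>v\<in>B. f v * sum g B - f v * g v)"
      using assms by (intro sum.cong) (auto simp: sum_diff1 right_diff_distrib)
    then show ?thesis by (simp add: sum_subtractf sum_distrib_right)
  qed
  then show ?thesis by (simp add: mult.commute)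
qed

context smooth_fano
begin

text \<open>In the relation \<open>v + opp B v = (\<Sum>w\<in>B - {v}. a\<^sub>w w)\<close> this is \<open>\<Sum> a\<^sub>w = 2 + K \<cdot> C\<close>, where \<open>C\<close> is the
  curve of the ridge \<open>B - {v}\<close>.\<close>

definition wt :: "(real ^ 'n) set \<Rightarrow> real ^ 'n \<Rightarrow> real" where
  "wt B v = (\<Sum>w\<in>B - {v}. coord B w (opp B v))"

lemma wt_eq: "B \<in> \<B> \<Longrightarrow> v \<in> B \<Longrightarrow> wt B v = ht B (opp B v) + 1"
  unfolding wt_def ht_def using coord_opp finite_B by (simp add: sum_diff1)

lemma opp_lattice: "B \<in> \<B> \<Longrightarrow> v \<in> B \<Longrightarrow> opp B v \<in> integer_lattice"
  using vertices_lattice[OF opp(2)] by (auto simp: flip_def)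

text \<open>Pair each flag with the one across its ridge. By oddness of \<open>p\<close> the two
  terms cancel except for the change of the \<open>q\<close>-values, whose coefficients add up to
  \<open>wt B v\<close>. The rule for \<open>q\<close> is demanded only where \<open>p\<close> is
  nonzero so that \<open>p\<close> can be a jump supported on walls.\<close>

lemma flag_pairing:
  assumes odd: "\<And>B v. B \<in> \<B> \<Longrightarrow> v \<in> B \<Longrightarrow> p (flip B v) (opp B v) = - p B v"
    and step: "\<And>B v w. B \<in> \<B> \<Longrightarrow> v \<in> B \<Longrightarrow> w \<in> B - {v} \<Longrightarrow> p B v \<noteq> 0 \<Longrightarrow>
      q (flip B v) w = q B w + coord B w (opp B v) * c B v"
  shows "2 * (\<Sum>B\<in>\<B>. \<Sum>v\<in>B. p B v * (\<Sum>w\<in>B - {v}. q B w)) = - (\<Sum>B\<in>\<B>. \<Sum>v\<in>B. wt B v * p B v * (c B v :: real))"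
proof -
  let ?S = "\<Sum>B\<in>\<B>. \<Sum>v\<in>B. p B v * (\<Sum>w\<in>B - {v}. q B w)"
  have "?S = (\<Sum>B\<in>\<B>. \<Sum>v\<in>B. p (flip B v) (opp B v) * (\<Sum>w\<in>flip B v - {opp B v}. q (flip B v) w))"
    by (rule sum_flip)
  also have "\<dots> = (\<Sum>B\<in>\<B>. \<Sum>v\<in>B. - (p B v * (\<Sum>w\<in>B - {v}. q B w)) - wt B v * p B v * c B v)"
  proof (intro sum.cong refl)
    fix B v assume Bv: "B \<in> \<B>" "v \<in> B"
    show "p (flip B v) (opp B v) * (\<Sum>w\<in>flip B v - {opp B v}. q (flip B v) w) =
      - (p B v * (\<Sum>w\<in>B - {v}. q B w)) - wt B v * p B v * c B v"
    proof (cases "p B v = 0")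
      case True
      then show ?thesis using odd[OF Bv] by simp
    next
      case False
      have "(\<Sum>w\<in>flip B v - {opp B v}. q (flip B v) w) = (\<Sum>w\<in>B - {v}. q B w + coord B w (opp B v) * c B v)"
        unfolding flip_minus[OF Bv] using step[OF Bv] False by (intro sum.cong) auto
      also have "\<dots> = (\<Sum>w\<in>B - {v}. q B w) + wt B v * c B v"
        by (simp add: sum.distrib wt_def sum_distrib_right)
      finally show ?thesis using odd[OF Bv] by (simp add: algebra_simps)
    qed
  qed
  also have "\<dots> = - ?S - (\<Sum>B\<in>\<B>. \<Sum>v\<in>B. wt B v * p B v * c B v)"
    by (simp add: sum_subtractf sum_negf)
  finally show ?thesis by simp
qed

text \<open>\<open>floor_sum\<close> and \<open>saw_sum\<close> differ by a constant off the integer translates of the walls. \<open>floor_sum\<close> depends on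
  floors and ceilings only, hence is locally constant away from these walls, while \<open>saw_sum\<close> is periodic
  and satisfies a distribution relation. Using \<open>\<lfloor>a\<rfloor> * \<lceil>a\<rceil>\<close> instead of \<open>(mid a)\<^sup>2\<close> makes \<open>floor_sum\<close> constant
  across a wall, including on the wall itself.\<close>

definition floor_sum :: "real ^ 'n \<Rightarrow> real" where
  "floor_sum x = (\<Sum>B\<in>\<B>. \<Sum>v\<in>B. mid (coord B v x) * (\<Sum>w\<in>B - {v}. mid (coord B w x)))
    + (\<Sum>B\<in>\<B>. \<Sum>v\<in>B. wt B v * of_int (\<lfloor>coord B v x\<rfloor> * \<lceil>coord B v x\<rceil>)) / 2"

definition saw_sum :: "real ^ 'n \<Rightarrow> real" where
  "saw_sum x = (\<Sum>B\<in>\<B>. \<Sum>v\<in>B. saw (coord B v x) * (\<Sum>w\<in>B - {v}. saw (coord B w x)))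
    + (\<Sum>B\<in>\<B>. \<Sum>v\<in>B. wt B v * ((saw (coord B v x))\<^sup>2 - 1 / 12)) / 2"

text \<open>Each ridge is counted from both sides. Since the curves of the ridges together represent
  \<open>c_(d-1)\<close>, this is, up to a multiple of the number of ridges, the Chern number
  \<open>c_1 c_(d-1)\<close>.\<close>

definition total_wt :: real where
  "total_wt = (\<Sum>B\<in>\<B>. \<Sum>v\<in>B. wt B v)"

text \<open>Expand \<open>saw\<close> as coordinate minus \<open>mid\<close>. The pairings
  \<open>xx\<close> and \<open>mx\<close> turn every product involving a raw coordinate into a sum
  weighted by \<open>wt\<close>, which cancels against the expansion of the squares. The constant is
  half of 1/4 - 1/12, with 1/4 from \<open>floor_times_ceiling\<close>.\<close>

lemma saw_sum_eq_floor_sum: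
  assumes "\<And>B v. B \<in> \<B> \<Longrightarrow> v \<in> B \<Longrightarrow> coord B v x \<notin> \<int>"
  shows "saw_sum x = floor_sum x + total_wt / 12"
proof -
  let ?S = "\<lambda>f g. \<Sum>B\<in>\<B>. \<Sum>v\<in>B. f B v * (\<Sum>w\<in>B - {v}. g B w) :: real"
  let ?x = "\<lambda>B v. coord B v x" and ?m = "\<lambda>B v. mid (coord B v x)"
  have xx: "2 * ?S ?x ?x = - (\<Sum>B\<in>\<B>. \<Sum>v\<in>B. wt B v * ?x B v * ?x B v)"
    by (rule flag_pairing) (auto simp: coord_flip_opp coord_flip)
  have mx: "2 * ?S ?m ?x = - (\<Sum>B\<in>\<B>. \<Sum>v\<in>B. wt B v * ?m B v * ?x B v)"
    by (rule flag_pairing) (auto simp: coord_flip_opp coord_flip mid_minus)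
  have xm: "?S ?x ?m = ?S ?m ?x"
    using finite_B by (intro sum.cong sum_offdiag_commute) auto
  have "(\<Sum>B\<in>\<B>. \<Sum>v\<in>B. saw (coord B v x) * (\<Sum>w\<in>B - {v}. saw (coord B w x))) =
    (\<Sum>B\<in>\<B>. \<Sum>v\<in>B. (?x B v * (\<Sum>w\<in>B - {v}. ?x B w) - ?x B v * (\<Sum>w\<in>B - {v}. ?m B w)) -
      (?m B v * (\<Sum>w\<in>B - {v}. ?x B w) - ?m B v * (\<Sum>w\<in>B - {v}. ?m B w)))"
    unfolding saw_def by (intro sum.cong refl) (simp add: sum_subtractf algebra_simps)
  also have "\<dots> = (?S ?x ?x - ?S ?x ?m) - (?S ?m ?x - ?S ?m ?m)" by (simp only: sum_subtractf)
  also have "\<dots> = ?S ?m ?m + (2 * ?S ?x ?x) / 2 - 2 * ?S ?m ?x" using xm by simp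
  also have "\<dots> = ?S ?m ?m - (\<Sum>B\<in>\<B>. \<Sum>v\<in>B. wt B v * ?x B v * ?x B v) / 2
      + (\<Sum>B\<in>\<B>. \<Sum>v\<in>B. wt B v * ?m B v * ?x B v)" unfolding xx mx by simp
  finally have 1: "(\<Sum>B\<in>\<B>. \<Sum>v\<in>B. saw (coord B v x) * (\<Sum>w\<in>B - {v}. saw (coord B w x))) =
     ?S ?m ?m - (\<Sum>B\<in>\<B>. \<Sum>v\<in>B. wt B v * ?x B v * ?x B v) / 2
      + (\<Sum>B\<in>\<B>. \<Sum>v\<in>B. wt B v * ?m B v * ?x B v)" .
  have "(\<Sum>B\<in>\<B>. \<Sum>v\<in>B. wt B v * ((saw (coord B v x))\<^sup>2 - 1 / 12)) =
    (\<Sum>B\<in>\<B>. \<Sum>v\<in>B. (wt B v * ?x B v * ?x B v - 2 * (wt B v * ?m B v * ?x B v)) +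
      (wt B v * of_int (\<lfloor>coord B v x\<rfloor> * \<lceil>coord B v x\<rceil>) + (1 / 6) * wt B v))"
  proof (intro sum.cong refl)
    fix B v assume "B \<in> \<B>" "v \<in> B"
    then have e: "real_of_int (\<lfloor>coord B v x\<rfloor> * \<lceil>coord B v x\<rceil>) = (mid (coord B v x))\<^sup>2 - 1 / 4"
      using assms floor_times_ceiling by blast
    show "wt B v * ((saw (coord B v x))\<^sup>2 - 1 / 12) = (wt B v * ?x B v * ?x B v - 2 * (wt B v * ?m B v * ?x B v)) +
      (wt B v * of_int (\<lfloor>coord B v x\<rfloor> * \<lceil>coord B v x\<rceil>) + (1 / 6) * wt B v)"
      unfolding e saw_def by (simp add: power2_eq_square field_simps)
  qed
  also have "\<dots> = (\<Sum>B\<in>\<B>. \<Sum>v\<in>B. wt B v * ?x B v * ?x B v) - 2 * (\<Sum>B\<in>\<B>. \<Sum>v\<in>B. wt B v * ?m B v * ?x B v)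
     + ((\<Sum>B\<in>\<B>. \<Sum>v\<in>B. wt B v * of_int (\<lfloor>coord B v x\<rfloor> * \<lceil>coord B v x\<rceil>)) + (1 / 6) * total_wt)"
    unfolding total_wt_def by (simp only: sum_subtractf sum.distrib sum_distrib_left)
  finally have 2: "(\<Sum>B\<in>\<B>. \<Sum>v\<in>B. wt B v * ((saw (coord B v x))\<^sup>2 - 1 / 12)) =
    (\<Sum>B\<in>\<B>. \<Sum>v\<in>B. wt B v * ?x B v * ?x B v) - 2 * (\<Sum>B\<in>\<B>. \<Sum>v\<in>B. wt B v * ?m B v * ?x B v)
     + ((\<Sum>B\<in>\<B>. \<Sum>v\<in>B. wt B v * of_int (\<lfloor>coord B v x\<rfloor> * \<lceil>coord B v x\<rceil>)) + (1 / 6) * total_wt)" .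
  show ?thesis unfolding saw_sum_def floor_sum_def 1 2 by (simp add: add_divide_distrib diff_divide_distrib del: of_int_mult)
qed

text \<open>The hypothesis says that in each cone at most one coordinate of \<open>x\<close> is
  integral. By the pairing across ridges, the jump of the product sum then cancels the jump of the
  floor-ceiling sum.\<close>

lemma floor_sum_locally_constant:
  assumes "\<And>B v w. B \<in> \<B> \<Longrightarrow> v \<in> B \<Longrightarrow> w \<in> B \<Longrightarrow> v \<noteq> w \<Longrightarrow> coord B v x \<in> \<int> \<Longrightarrow> coord B w x \<notin> \<int>"
  shows "eventually (\<lambda>e. floor_sum (x + e *\<^sub>R u) = floor_sum x) (at 0)"
proof -
  let ?P = "\<lambda>a c e. (mid (a + e * c) \<noteq> mid a \<longrightarrow> a \<in> \<int>) \<and>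
     real_of_int (\<lfloor>a + e * c\<rfloor> * \<lceil>a + e * c\<rceil>) = of_int (\<lfloor>a\<rfloor> * \<lceil>a\<rceil>) + 2 * mid a * (mid (a + e * c) - mid a)"
  have "eventually (\<lambda>e. \<forall>B\<in>\<B>. \<forall>v\<in>B. ?P (coord B v x) (coord B v u) e) (at 0)"
    using finite_cones finite_B by (intro eventually_ball_finite ballI eventually_mid) auto
  then show ?thesis
  proof (rule eventually_mono)
    fix e assume e: "\<forall>B\<in>\<B>. \<forall>v\<in>B. ?P (coord B v x) (coord B v u) e"
    define z where "z = x + e *\<^sub>R u"
    define D where "D B v = mid (coord B v z) - mid (coord B v x)" for B v
    let ?m = "\<lambda>B v. mid (coord B v x)"
    have z: "coord B v z = coord B v x + e * coord B v u" if "B \<in> \<B>" for B v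
      using that by (simp add: z_def coord_add coord_scale)
    have D: "coord B v x \<in> \<int>" if "B \<in> \<B>" "v \<in> B" "D B v \<noteq> 0" for B v
      using e that z unfolding D_def by (metis cancel_comm_monoid_add_class.diff_cancel)
    have fc: "real_of_int (\<lfloor>coord B v z\<rfloor> * \<lceil>coord B v z\<rceil>) = of_int (\<lfloor>coord B v x\<rfloor> * \<lceil>coord B v x\<rceil>) + 2 * ?m B v * D B v"
      if "B \<in> \<B>" "v \<in> B" for B v
      using e that z unfolding D_def by metis
    \<comment> \<open>Where \<open>D B v\<close> is nonzero, \<open>coord B v x\<close> is an
      integer, so \<open>mid\<close> is additive in the wall-crossing formula and
      \<open>flag_pairing\<close> applies.\<close>
    have pair: "2 * (\<Sum>B\<in>\<B>. \<Sum>v\<in>B. D B v * (\<Sum>w\<in>B - {v}. ?m B w)) = - (\<Sum>B\<in>\<B>. \<Sum>v\<in>B. wt B v * D B v * ?m B v)"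
    proof (rule flag_pairing)
      fix B v assume Bv: "B \<in> \<B>" "v \<in> B"
      show "D (flip B v) (opp B v) = - D B v"
        using Bv unfolding D_def by (simp add: coord_flip_opp mid_minus)
      fix w assume w: "w \<in> B - {v}" and "D B v \<noteq> 0"
      then have "coord B v x \<in> \<int>" using D Bv by blast
      moreover have "coord B w (opp B v) \<in> \<int>" using Bv w opp_lattice by (intro coord_Ints) auto
      ultimately show "?m (flip B v) w = ?m B w + coord B w (opp B v) * ?m B v"
        using Bv w by (simp add: coord_flip mid_add_Ints mid_Ints)
    qed
    have sym: "(\<Sum>B\<in>\<B>. \<Sum>v\<in>B. ?m B v * (\<Sum>w\<in>B - {v}. D B w)) = (\<Sum>B\<in>\<B>. \<Sum>v\<in>B. D B v * (\<Sum>w\<in>B - {v}. ?m B w))"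
      using finite_B by (intro sum.cong sum_offdiag_commute) auto
    have "(\<Sum>B\<in>\<B>. \<Sum>v\<in>B. mid (coord B v z) * (\<Sum>w\<in>B - {v}. mid (coord B w z))) =
      (\<Sum>B\<in>\<B>. \<Sum>v\<in>B. ?m B v * (\<Sum>w\<in>B - {v}. ?m B w) + (?m B v * (\<Sum>w\<in>B - {v}. D B w) + D B v * (\<Sum>w\<in>B - {v}. ?m B w)))"
    proof (intro sum.cong refl)
      fix B v assume Bv: "B \<in> \<B>" "v \<in> B"
      have mz: "mid (coord B w z) = ?m B w + D B w" for w by (simp add: D_def)
      \<comment> \<open>Two coordinates of one cone never jump together, so there is no term of
        second order in the jumps.\<close>
      have "D B v * (\<Sum>w\<in>B - {v}. D B w) = 0"
      proof (cases "D B v = 0")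
        case False
        then have "D B w = 0" if "w \<in> B - {v}" for w using D assms Bv that by (metis DiffE insertI1)
        then show ?thesis by simp
      qed simp
      then show "mid (coord B v z) * (\<Sum>w\<in>B - {v}. mid (coord B w z)) =
        ?m B v * (\<Sum>w\<in>B - {v}. ?m B w) + (?m B v * (\<Sum>w\<in>B - {v}. D B w) + D B v * (\<Sum>w\<in>B - {v}. ?m B w))"
        unfolding mz sum.distrib by (simp add: algebra_simps)
    qed
    then have 1: "(\<Sum>B\<in>\<B>. \<Sum>v\<in>B. mid (coord B v z) * (\<Sum>w\<in>B - {v}. mid (coord B w z))) =
      (\<Sum>B\<in>\<B>. \<Sum>v\<in>B. ?m B v * (\<Sum>w\<in>B - {v}. ?m B w)) + 2 * (\<Sum>B\<in>\<B>. \<Sum>v\<in>B. D B v * (\<Sum>w\<in>B - {v}. ?m B w))"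
      by (simp only: sum.distrib sym mult_2)
    have "(\<Sum>B\<in>\<B>. \<Sum>v\<in>B. wt B v * of_int (\<lfloor>coord B v z\<rfloor> * \<lceil>coord B v z\<rceil>)) =
      (\<Sum>B\<in>\<B>. \<Sum>v\<in>B. wt B v * of_int (\<lfloor>coord B v x\<rfloor> * \<lceil>coord B v x\<rceil>) + 2 * (wt B v * D B v * ?m B v))"
      using fc by (intro sum.cong refl) (simp only: distrib_left, simp add: mult.commute mult.left_commute)
    then have 2: "(\<Sum>B\<in>\<B>. \<Sum>v\<in>B. wt B v * of_int (\<lfloor>coord B v z\<rfloor> * \<lceil>coord B v z\<rceil>)) =
      (\<Sum>B\<in>\<B>. \<Sum>v\<in>B. wt B v * of_int (\<lfloor>coord B v x\<rfloor> * \<lceil>coord B v x\<rceil>)) + 2 * (\<Sum>B\<in>\<B>. \<Sum>v\<in>B. wt B v * D B v * ?m B v)"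
      by (simp only: sum.distrib sum_distrib_left)
    show "floor_sum (x + e *\<^sub>R u) = floor_sum x"
      unfolding z_def[symmetric] floor_sum_def 1 2 pair by (simp add: add_divide_distrib del: of_int_mult)
  qed
qed

lemma generic_coord:
  assumes "generic x" "B \<in> \<B>" "v \<in> B" shows "coord B v x \<notin> \<int>"
proof -
  have "coord B v v \<noteq> 0" using assms by (simp add: coord_basis)
  then show ?thesis using assms linear_coord coord_Ints unfolding generic_def by blast
qed

text \<open>Along a lattice direction a generic line meets the translated walls of a cone one at a
  time, as \<open>floor_sum_locally_constant\<close> requires.\<close>

lemma generic_line:
  assumes x: "generic x" and u: "u \<in> integer_lattice" and B: "B \<in> \<B>" "v \<in> B" "w \<in> B" "v \<noteq> w"
    and "coord B v (x + t *\<^sub>R u) \<in> \<int>"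
  shows "coord B w (x + t *\<^sub>R u) \<notin> \<int>"
proof
  assume w: "coord B w (x + t *\<^sub>R u) \<in> \<int>"
  \<comment> \<open>This combination eliminates \<open>t\<close>, so it is an integral form with an
    integer value at \<open>x\<close>. Genericity forces it to vanish, which makes
    \<open>coord B v\<close> constant along the line.\<close>
  define f where "f y = coord B w u * coord B v y - coord B v u * coord B w y" for y
  have Ints: "coord B v u \<in> \<int>" "coord B w u \<in> \<int>" using coord_Ints B u by auto
  have "f (x + t *\<^sub>R u) = f x" using B by (simp add: f_def coord_add coord_scale algebra_simps)
  moreover have "f (x + t *\<^sub>R u) \<in> \<int>" using assms(7) w Ints unfolding f_def by auto
  ultimately have fx: "f x \<in> \<int>" by simp
  have "linear f" unfolding f_def
    by (rule linearI) (simp_all add: B coord_add coord_scale algebra_simps)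
  moreover have "\<forall>y\<in>integer_lattice. f y \<in> \<int>" using Ints B coord_Ints unfolding f_def by auto
  ultimately have f0: "f y = 0" for y using x fx unfolding generic_def by blast
  have "f v = coord B w u" "f w = - coord B v u" using B by (auto simp: f_def coord_basis)
  then have "coord B v u = 0" using f0 by simp
  then have "coord B v x \<in> \<int>" using assms(7) B by (simp add: coord_add coord_scale)
  then show False using generic_coord x B by blast
qed

text \<open>A function that is locally constant on a connected line is constant.\<close>

lemma floor_sum_shift:
  assumes x: "generic x" and u: "u \<in> integer_lattice"
  shows "floor_sum (x + t *\<^sub>R u) = floor_sum x"
proof -
  have "eventually (\<lambda>s. floor_sum (x + r *\<^sub>R u) = floor_sum (x + s *\<^sub>R u)) (at r)" for r
  proof -
    have "eventually (\<lambda>e. floor_sum ((x + r *\<^sub>R u) + e *\<^sub>R u) = floor_sum (x + r *\<^sub>R u)) (at 0)"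
      using generic_line[OF x u] by (intro floor_sum_locally_constant) blast
    then have "eventually (\<lambda>s. floor_sum ((x + r *\<^sub>R u) + (s - r) *\<^sub>R u) = floor_sum (x + r *\<^sub>R u)) (at r)"
      by (subst (asm) at_to_0[symmetric, of r] | subst eventually_at_to_0) (simp add: algebra_simps)
    then show ?thesis by (rule eventually_mono) (simp add: algebra_simps)
  qed
  then show ?thesis
    using connected_local_const[of UNIV t 0 "\<lambda>s. floor_sum (x + s *\<^sub>R u)"] by auto
qed

text \<open>Adding the vertex \<open>v\<close> to \<open>l\<close> moves only the
  \<open>v\<close>-coordinate of \<open>y l\<close> within its cone, and moves it by 1/2. Averaging
  over such pairs brings in the distribution relations: each sawtooth factor contributes 1/2, the
  corrected square 1/4.\<close>

lemma torsion_average: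
  assumes x: "\<And>B v. B \<in> \<B> \<Longrightarrow> v \<in> B \<Longrightarrow> 2 * coord B v x \<notin> \<int>"
  shows "(\<Sum>l\<in>torsion. saw_sum (x + (1 / 2) *\<^sub>R l)) = real (card (torsion :: (real ^ 'n) set)) * saw_sum (2 *\<^sub>R x) / 4"
proof -
  let ?T = "torsion :: (real ^ 'n) set"
  define y where "y l = x + (1 / 2) *\<^sub>R l" for l
  have y: "coord B v (y l) = coord B v x + coord B v l / 2" if "B \<in> \<B>" for B v l
    using that by (simp add: y_def coord_add coord_scale)
  have yv: "coord B w (y (l + v)) = (if w = v then coord B v (y l) + 1 / 2 else coord B w (y l))"
    if "B \<in> \<B>" "v \<in> B" for B v w l
    using that by (simp add: y coord_add coord_basis add_divide_distrib)
  have per: "saw (coord B v (y (l + 2 *\<^sub>R k))) = saw (coord B v (y l))" 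
    if "B \<in> \<B>" "v \<in> B" "k \<in> integer_lattice" for B v l k
    using saw_add_Ints[OF coord_Ints[OF that], of "coord B v (y l)"] that by (simp add: y coord_add coord_scale add.assoc add_divide_distrib)
  have two: "2 * coord B v (y l) = 2 * coord B v x + coord B v l" if "B \<in> \<B>" for B v l
    using that by (simp add: y)
  have nonint: "2 * coord B v (y l) \<notin> \<int>" if "B \<in> \<B>" "v \<in> B" "l \<in> ?T" for B v l
  proof
    assume "2 * coord B v (y l) \<in> \<int>"
    moreover have "coord B v l \<in> \<int>" using that torsion_lattice by (intro coord_Ints) auto
    ultimately have "2 * coord B v (y l) - coord B v l \<in> \<int>" by (rule Ints_diff)
    then show False using x that two by simp
  qed
  have saw2: "saw (2 * coord B v (y l)) = saw (coord B v (2 *\<^sub>R x))" if "B \<in> \<B>" "v \<in> B" "l \<in> ?T" for B v l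
    using that torsion_lattice coord_Ints[of B v l] by (auto simp: two coord_scale saw_add_Ints)
  have vl: "v \<in> integer_lattice" if "B \<in> \<B>" "v \<in> B" for B v using vertices_lattice that by auto
  have shift1: "2 * (\<Sum>l\<in>?T. g l) = (\<Sum>l\<in>?T. g l + g (l + v))"
    if "B \<in> \<B>" "v \<in> B" "\<And>l k. l \<in> integer_lattice \<Longrightarrow> k \<in> integer_lattice \<Longrightarrow> g (l + 2 *\<^sub>R k) = g l" for B v and g :: "real ^ 'n \<Rightarrow> real"
    using sum_torsion_shift[of v g] that vl by (simp add: sum.distrib)
  have s1: "(\<Sum>l\<in>?T. saw (coord B w (y l))) = card ?T * saw (coord B w (2 *\<^sub>R x)) / 2" if "B \<in> \<B>" "w \<in> B" for B w
  proof -
    have "2 * (\<Sum>l\<in>?T. saw (coord B w (y l))) = (\<Sum>l\<in>?T. saw (coord B w (y l)) + saw (coord B w (y (l + w))))"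
      using that per by (intro shift1[of B w]) auto
    also have "\<dots> = (\<Sum>l\<in>?T. saw (coord B w (2 *\<^sub>R x)))"
      using that saw_half[OF nonint[OF that]] saw2[OF that] by (intro sum.cong) (auto simp: yv)
    finally show ?thesis by simp
  qed
  \<comment> \<open>The shift by \<open>v\<close> resolves the first factor, after which
    \<open>s1\<close> averages the second.\<close>
  have s2: "(\<Sum>l\<in>?T. saw (coord B v (y l)) * saw (coord B w (y l))) = card ?T * (saw (coord B v (2 *\<^sub>R x)) * saw (coord B w (2 *\<^sub>R x))) / 4"
    if "B \<in> \<B>" "v \<in> B" "w \<in> B" "v \<noteq> w" for B v w
  proof -
    have "2 * (\<Sum>l\<in>?T. saw (coord B v (y l)) * saw (coord B w (y l))) = 
      (\<Sum>l\<in>?T. saw (coord B v (y l)) * saw (coord B w (y l)) + saw (coord B v (y (l + v))) * saw (coord B w (y (l + v))))"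
      using that per by (intro shift1[of B v]) auto
    also have "\<dots> = (\<Sum>l\<in>?T. saw (coord B v (2 *\<^sub>R x)) * saw (coord B w (y l)))"
    proof (rule sum.cong)
      fix l assume l: "l \<in> ?T"
      have "saw (coord B v (y l)) + saw (coord B v (y l) + 1 / 2) = saw (coord B v (2 *\<^sub>R x))"
        using saw_half[OF nonint] saw2 that l by simp
      then show "saw (coord B v (y l)) * saw (coord B w (y l)) + saw (coord B v (y (l + v))) * saw (coord B w (y (l + v))) =
        saw (coord B v (2 *\<^sub>R x)) * saw (coord B w (y l))"
        using that by (simp add: yv flip: distrib_right)
    qed simp
    also have "\<dots> = saw (coord B v (2 *\<^sub>R x)) * (card ?T * saw (coord B w (2 *\<^sub>R x)) / 2)"
      using s1 that by (simp flip: sum_distrib_left)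
    finally show ?thesis by (simp add: mult_ac)
  qed
  have s3: "(\<Sum>l\<in>?T. (saw (coord B v (y l)))\<^sup>2 - 1 / 12) = card ?T * ((saw (coord B v (2 *\<^sub>R x)))\<^sup>2 - 1 / 12) / 4"
    if "B \<in> \<B>" "v \<in> B" for B v
  proof -
    have "2 * (\<Sum>l\<in>?T. (saw (coord B v (y l)))\<^sup>2 - 1 / 12) = 
      (\<Sum>l\<in>?T. ((saw (coord B v (y l)))\<^sup>2 - 1 / 12) + ((saw (coord B v (y (l + v))))\<^sup>2 - 1 / 12))"
      using that per by (intro shift1[of B v]) auto
    also have "\<dots> = (\<Sum>l\<in>?T. ((saw (coord B v (2 *\<^sub>R x)))\<^sup>2 - 1 / 12) / 2)"
    proof (rule sum.cong)
      fix l assume l: "l \<in> ?T"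
      show "((saw (coord B v (y l)))\<^sup>2 - 1 / 12) + ((saw (coord B v (y (l + v))))\<^sup>2 - 1 / 12) = ((saw (coord B v (2 *\<^sub>R x)))\<^sup>2 - 1 / 12) / 2"
        using saw_square_half[OF nonint[OF that l]] saw2[OF that l] yv[OF that, of v l] by simp
    qed simp
    finally show ?thesis by simp
  qed
  have "(\<Sum>l\<in>?T. saw_sum (y l)) = 
     (\<Sum>B\<in>\<B>. \<Sum>v\<in>B. \<Sum>w\<in>B - {v}. \<Sum>l\<in>?T. saw (coord B v (y l)) * saw (coord B w (y l)))
     + (\<Sum>B\<in>\<B>. \<Sum>v\<in>B. wt B v * (\<Sum>l\<in>?T. (saw (coord B v (y l)))\<^sup>2 - 1 / 12)) / 2"
    unfolding saw_sum_def sum.distrib sum_distrib_left sum_divide_distrib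
    by (subst sum.swap[of _ _ ?T], subst sum.swap[of _ _ ?T], subst sum.swap[of _ _ ?T]) (simp add: sum.swap[of _ _ ?T])
  also have "\<dots> = (\<Sum>B\<in>\<B>. \<Sum>v\<in>B. \<Sum>w\<in>B - {v}. card ?T * (saw (coord B v (2 *\<^sub>R x)) * saw (coord B w (2 *\<^sub>R x))) / 4)
     + (\<Sum>B\<in>\<B>. \<Sum>v\<in>B. wt B v * (card ?T * ((saw (coord B v (2 *\<^sub>R x)))\<^sup>2 - 1 / 12) / 4)) / 2"
    using s2 s3 by (intro arg_cong2[where f = "(+)"] arg_cong2[where f = "(/)"] sum.cong) auto
  also have "\<dots> = card ?T * saw_sum (2 *\<^sub>R x) / 4"
    unfolding saw_sum_def by (simp add: sum_distrib_left sum_divide_distrib distrib_left add_divide_distrib mult_ac)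
  finally show ?thesis unfolding y_def .
qed

text \<open>Near the origin \<open>floor_sum\<close> agrees at \<open>x\<close> and
  \<open>2 *\<^sub>R x\<close>, hence so does \<open>saw_sum\<close>; by averaging the first value
  is also a quarter of the second. So both vanish, and \<open>total_wt\<close> is
  \<open>- 12\<close> times the explicit value of \<open>floor_sum\<close>.\<close>

theorem total_wt_eq:
  obtains x where "off_walls x" 
    "total_wt = - 3 * (\<Sum>i\<le>CARD('n). real (hvec x i) * ((real CARD('n) - 2 * real i)\<^sup>2 - real CARD('n)))"
proof -
  obtain z :: "real ^ 'n" where z: "generic z" using generic_exists by auto
  define N where "N = (\<Sum>B\<in>\<B>. \<Sum>v\<in>B. \<bar>coord B v z\<bar>)"
  have N: "\<bar>coord B v z\<bar> \<le> N" if "B \<in> \<B>" "v \<in> B" for B v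
  proof -
    have "\<bar>coord B v z\<bar> \<le> (\<Sum>v\<in>B. \<bar>coord B v z\<bar>)" using that finite_B by (intro member_le_sum) auto
    also have "\<dots> \<le> N" unfolding N_def using that finite_cones by (intro member_le_sum sum_nonneg) auto
    finally show ?thesis .
  qed
  obtain k :: nat where k: "N < real k" "k > 0"
    using reals_Archimedean2[of "max N 1"] by (metis max_less_iff_conj of_nat_0_less_iff zero_less_one_class.zero_less_one order.strict_trans)
  \<comment> \<open>The factor 2 keeps the coordinates of \<open>2 *\<^sub>R x\<close>, and not only
    those of \<open>x\<close>, below 1 in absolute value.\<close>
  define x where "x = inverse (real (2 * k)) *\<^sub>R z"
  have x: "generic x" unfolding x_def using z k by (intro generic_scale) auto
  have x2': "2 *\<^sub>R x = inverse (real k) *\<^sub>R z" using k by (simp add: x_def)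
  have x2: "generic (2 *\<^sub>R x)" unfolding x2' using z k by (intro generic_scale) auto
  have nz: "coord B v x \<noteq> 0" if "B \<in> \<B>" "v \<in> B" for B v using generic_coord[OF x that] by auto
  have small: "\<bar>2 * coord B v x\<bar> < 1" if "B \<in> \<B>" "v \<in> B" for B v
  proof -
    have "2 * coord B v x = coord B v (2 *\<^sub>R x)" using that by (simp add: coord_scale)
    also have "\<dots> = coord B v z / real k" unfolding x2' using that by (simp add: coord_scale field_simps)
    finally have e: "2 * coord B v x = coord B v z / real k" .
    show ?thesis unfolding e using N[OF that] k by (simp add: abs_divide)
  qed
  have nonint: "2 * coord B v x \<notin> \<int>" if "B \<in> \<B>" "v \<in> B" for B v
    using generic_coord[OF x2 that] that by (simp add: coord_scale)
  have M1: "saw_sum x = floor_sum x + total_wt / 12" using generic_coord[OF x] by (rule saw_sum_eq_floor_sum)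
  have M2: "saw_sum (2 *\<^sub>R x) = floor_sum (2 *\<^sub>R x) + total_wt / 12" using generic_coord[OF x2] by (rule saw_sum_eq_floor_sum)
  \<comment> \<open>A half-lattice translate lies on a lattice line through \<open>x\<close>, along
    which \<open>floor_sum\<close> is constant.\<close>
  have M3: "saw_sum (x + (1 / 2) *\<^sub>R l) = saw_sum x" if "l \<in> torsion" for l
  proof -
    have l: "l \<in> integer_lattice" using that torsion_lattice by auto
    have "saw_sum (x + (1 / 2) *\<^sub>R l) = floor_sum (x + (1 / 2) *\<^sub>R l) + total_wt / 12"
    proof (rule saw_sum_eq_floor_sum)
      fix B v assume Bv: "B \<in> \<B>" "v \<in> B"
      show "coord B v (x + (1 / 2) *\<^sub>R l) \<notin> \<int>"
      proof
        assume "coord B v (x + (1 / 2) *\<^sub>R l) \<in> \<int>"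
        then have "2 * coord B v (x + (1 / 2) *\<^sub>R l) - coord B v l \<in> \<int>"
          using coord_Ints[OF Bv l] by (intro Ints_diff Ints_mult) auto
        then show False using nonint[OF Bv] Bv by (simp add: coord_add coord_scale)
      qed
    qed
    then show ?thesis using floor_sum_shift[OF x l] M1 by simp
  qed
  define sg where "sg B v = (if coord B v x < 0 then - 1 else 1 :: real)" for B v
  have midfl: "mid a = (if a < 0 then - 1 else 1) / 2 \<and> \<lfloor>a\<rfloor> * \<lceil>a\<rceil> = 0" if "a \<noteq> 0" "\<bar>a\<bar> < 1" for a :: real
  proof -
    have "(a < 0 \<and> \<lfloor>a\<rfloor> = - 1 \<and> \<lceil>a\<rceil> = 0) \<or> (a > 0 \<and> \<lfloor>a\<rfloor> = 0 \<and> \<lceil>a\<rceil> = 1)" using that by linarith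
    then show ?thesis by (auto simp: mid_def)
  qed
  let ?Q = "\<Sum>B\<in>\<B>. \<Sum>v\<in>B. sg B v * (\<Sum>w\<in>B - {v}. sg B w)"
  have Ks: "floor_sum u = ?Q / 4" if u: "\<And>B v. B \<in> \<B> \<Longrightarrow> v \<in> B \<Longrightarrow> coord B v u \<noteq> 0 \<and> \<bar>coord B v u\<bar> < 1 \<and> (coord B v u < 0 \<longleftrightarrow> coord B v x < 0)" for u
  proof -
    have m: "mid (coord B v u) = sg B v / 2" if "B \<in> \<B>" "v \<in> B" for B v
      using midfl[of "coord B v u"] u[OF that] by (simp add: sg_def)
    have f: "\<lfloor>coord B v u\<rfloor> * \<lceil>coord B v u\<rceil> = 0" if "B \<in> \<B>" "v \<in> B" for B v
      using midfl[of "coord B v u"] u[OF that] by blast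
    have "(\<Sum>B\<in>\<B>. \<Sum>v\<in>B. wt B v * of_int (\<lfloor>coord B v u\<rfloor> * \<lceil>coord B v u\<rceil>)) = 0"
      by (intro sum.neutral ballI) (simp only: f of_int_0 mult_zero_right)
    moreover have "(\<Sum>B\<in>\<B>. \<Sum>v\<in>B. mid (coord B v u) * (\<Sum>w\<in>B - {v}. mid (coord B w u))) = (\<Sum>B\<in>\<B>. \<Sum>v\<in>B. sg B v / 2 * (\<Sum>w\<in>B - {v}. sg B w / 2))"
      using m by (intro sum.cong arg_cong2[where f = "(*)"]) auto
    ultimately show ?thesis unfolding floor_sum_def by (simp add: sum_divide_distrib[symmetric])
  qed
  have K1: "floor_sum x = ?Q / 4" using nz small by (intro Ks) force
  have K2: "floor_sum (2 *\<^sub>R x) = ?Q / 4" using nz small by (intro Ks) (simp add: coord_scale)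
  have "real (card (torsion :: (real ^ 'n) set)) * saw_sum x = real (card (torsion :: (real ^ 'n) set)) * saw_sum (2 *\<^sub>R x) / 4"
    using torsion_average[OF nonint] M3 by simp
  moreover have "real (card (torsion :: (real ^ 'n) set)) \<noteq> 0" using finite_torsion torsion_nonempty by (simp add: card_gt_0_iff)
  ultimately have "saw_sum x = saw_sum (2 *\<^sub>R x) / 4" by simp
  then have "saw_sum x = 0" using M1 M2 K1 K2 by simp
  then have tot: "total_wt = - 3 * ?Q" using M1 K1 by simp
  have "(\<Sum>v\<in>B. sg B v * (\<Sum>w\<in>B - {v}. sg B w)) = (real CARD('n) - 2 * real (neg B x))\<^sup>2 - real CARD('n)" if B: "B \<in> \<B>" for B
  proof -
    \<comment> \<open>Completing the square: the diagonal terms are squares of signs, hence 1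
      each.\<close>
    have "(\<Sum>v\<in>B. sg B v * (\<Sum>w\<in>B - {v}. sg B w)) = (\<Sum>v\<in>B. sg B v * (\<Sum>w\<in>B. sg B w) - 1)"
      using finite_B[OF B] by (intro sum.cong) (auto simp: sum_diff1 right_diff_distrib sg_def)
    also have "\<dots> = (\<Sum>v\<in>B. sg B v)\<^sup>2 - real CARD('n)"
      using card_B[OF B] by (simp add: sum_subtractf sum_distrib_right power2_eq_square)
    also have "(\<Sum>v\<in>B. sg B v) = (\<Sum>v\<in>B. 1 - 2 * (if coord B v x < 0 then 1 else 0))"
      by (intro sum.cong) (auto simp: sg_def)
    also have "\<dots> = real CARD('n) - 2 * real (neg B x)"
      using card_B[OF B] finite_B[OF B] by (simp add: sum_subtractf sum_distrib_left[symmetric] sum.If_cases neg_def Int_def)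
    finally show ?thesis .
  qed
  then have "?Q = (\<Sum>B\<in>\<B>. (real CARD('n) - 2 * real (neg B x))\<^sup>2 - real CARD('n))" by simp
  also have "\<dots> = (\<Sum>i\<le>CARD('n). real (hvec x i) * ((real CARD('n) - 2 * real i)\<^sup>2 - real CARD('n)))"
    by (rule sum_neg)
  finally show ?thesis using that[of x] tot nz unfolding off_walls_def by simp
qed

end

section \<open>Bounds on the h-vector\<close>

context smooth_fano
begin

definition vertices :: "(real ^ 'n) set" where
  "vertices = \<Union>\<B>"

section \<open>Lattice points of small height and the number of vertices\<close>

lemma finite_vertices: "finite vertices"
  unfolding vertices_def using finite_cones finite_B by auto

lemma vertices_in_lattice: "vertices \<subseteq> integer_lattice"
  unfolding vertices_def using vertices_lattice by auto

lemma zero_notin_vertices: "0 \<notin> vertices"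
  unfolding vertices_def using indep dependent_zero by auto

lemma nonneg_ht_0:
  assumes "B \<in> \<B>" "\<And>v. v \<in> B \<Longrightarrow> 0 \<le> coord B v y" "ht B y \<le> 0" shows "y = 0"
proof (rule coord_eqI[OF assms(1)])
  fix v assume v: "v \<in> B"
  have "ht B y = 0" using assms(2,3) unfolding ht_def by (simp add: antisym sum_nonneg)
  then show "coord B v y = coord B v 0"
    using assms v finite_B unfolding ht_def by (simp add: sum_nonneg_eq_0_iff coord_zero)
qed

text \<open>A nonzero lattice point has an integral coordinate at least 1 in its cone; subtracting
  that vertex stays in the cone and lowers the height by 1.\<close>

lemma lattice_points_Suc:
  assumes "y \<in> lattice_points (Suc m)" "y \<noteq> 0"
  obtains u v where "u \<in> lattice_points m" "v \<in> vertices" "y = u + v"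
proof -
  obtain B where B: "B \<in> \<B>" "\<And>v. v \<in> B \<Longrightarrow> 0 \<le> coord B v y" "ht B y \<le> real (Suc m)" and y: "y \<in> integer_lattice"
    using assms(1) unfolding lattice_points_def by auto
  obtain v where v: "v \<in> B" "coord B v y \<noteq> 0"
    using assms(2) coord_eqI[OF B(1), of y 0] B(1) by (auto simp: coord_zero)
  have "coord B v y \<in> \<int>" using coord_Ints B v y by blast
  then have one: "1 \<le> coord B v y" using v B(2)[OF v(1)] by (auto elim!: Ints_cases)
  have vl: "v \<in> integer_lattice" using vertices_lattice B v by auto
  have "y - v \<in> lattice_points m"
    unfolding lattice_points_def
  proof (intro CollectI conjI bexI[of _ B] ballI)
    show "y - v \<in> integer_lattice" using y vl by (simp add: integer_lattice_def)
    show "0 \<le> coord B w (y - v)" if "w \<in> B" for w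
      using that B v one by (simp add: coord_diff coord_basis)
    have "ht B (y - v) = ht B y - 1" using B v linear_diff[OF linear_ht] ht_basis by simp
    then show "ht B (y - v) \<le> real m" using B(3) by simp
  qed (use B in auto)
  moreover have "v \<in> vertices" using B v unfolding vertices_def by auto
  ultimately show ?thesis using that by force
qed

lemma lattice_points_0: "lattice_points 0 \<subseteq> {0}"
  unfolding lattice_points_def using nonneg_ht_0 by auto

lemma lattice_points_1: "lattice_points 1 = insert 0 vertices"
proof
  show "lattice_points 1 \<subseteq> insert 0 vertices"
  proof
    fix y assume y: "y \<in> lattice_points 1"
    show "y \<in> insert 0 vertices"
    proof (cases "y = 0")
      case False
      with y obtain u v where "u \<in> lattice_points 0" "v \<in> vertices" "y = u + v"
        using lattice_points_Suc[of y 0] by (metis One_nat_def)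
      then show ?thesis using lattice_points_0 by auto
    qed simp
  qed
  obtain B where "B \<in> \<B>" using covering by blast
  then have "0 \<in> lattice_points 1"
    unfolding lattice_points_def by (auto simp: coord_zero ht_zero integer_lattice_def)
  moreover have "v \<in> lattice_points 1" if v: "v \<in> vertices" for v
  proof -
    obtain B where "B \<in> \<B>" "v \<in> B" using v unfolding vertices_def by auto
    then show ?thesis unfolding lattice_points_def 
      using vertices_lattice by (intro CollectI conjI bexI[of _ B]) (auto simp: coord_basis ht_basis)
  qed
  ultimately show "insert 0 vertices \<subseteq> lattice_points 1" by auto
qed

lemma card_lattice_points_1: "card (lattice_points 1) = card vertices + 1"
  unfolding lattice_points_1 using finite_vertices zero_notin_vertices by simp

text \<open>A point of height at most 2 is zero, a vertex, a doubled vertex or a sum of two distinct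
  vertices. Bounding the last kind by all pairs is the trivial bound on the number of edges.\<close>

lemma card_lattice_points_2:
  "card (lattice_points 2) \<le> 1 + 2 * card vertices + (card vertices choose 2)"
proof -
  let ?V = vertices and ?P = "{S. S \<subseteq> vertices \<and> card S = 2}"
  have "lattice_points 2 \<subseteq> insert 0 ?V \<union> (\<lambda>v. v + v) ` ?V \<union> \<Sum> ` ?P"
  proof
    fix y assume y: "y \<in> lattice_points 2"
    show "y \<in> insert 0 ?V \<union> (\<lambda>v. v + v) ` ?V \<union> \<Sum> ` ?P"
    proof (cases "y = 0")
      case False
      then obtain u v where uv: "u \<in> insert 0 ?V" "v \<in> ?V" "y = u + v"
        using lattice_points_Suc[of y 1] y lattice_points_1 by (metis Suc_1)
      then consider "y \<in> ?V" | "y = v + v" | "u \<in> ?V" "u \<noteq> v" by auto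
      then show ?thesis
      proof cases
        case 3
        then have "y = \<Sum>{u, v}" "{u, v} \<in> ?P" using uv by auto
        then show ?thesis by blast
      qed (use uv in auto)
    qed simp
  qed
  then have "card (lattice_points 2) \<le> card (insert 0 ?V \<union> (\<lambda>v. v + v) ` ?V \<union> \<Sum> ` ?P)"
    using finite_vertices by (intro card_mono) auto
  also have "\<dots> \<le> card (insert 0 ?V) + card ((\<lambda>v. v + v) ` ?V) + card (\<Sum> ` ?P)"
    by (meson add_mono card_Un_le le_refl order_trans)
  also have "\<dots> \<le> (card ?V + 1) + card ?V + card ?P"
    using finite_vertices by (intro add_mono card_image_le) (auto simp: card_insert_if)
  also have "card ?P = card ?V choose 2" using finite_vertices by (rule n_subsets)
  finally show ?thesis by simp
qed

lemma ht_flip: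
  assumes "B \<in> \<B>" "v \<in> B"
  shows "ht (flip B v) y = ht B y + coord B v y * (wt B v - 2)"
proof -
  have fin: "finite B" using assms finite_B by blast
  have "ht (flip B v) y = coord (flip B v) (opp B v) y + (\<Sum>w\<in>B - {v}. coord (flip B v) w y)"
    using fin opp(1)[OF assms] unfolding ht_def by (simp add: flip_def)
  also have "(\<Sum>w\<in>B - {v}. coord (flip B v) w y) = (\<Sum>w\<in>B - {v}. coord B w y + coord B w (opp B v) * coord B v y)"
    using coord_flip[OF assms] by (intro sum.cong) auto
  also have "\<dots> = (ht B y - coord B v y) + wt B v * coord B v y"
    using fin assms by (simp add: sum.distrib wt_def ht_def sum_diff1 left_diff_distrib flip: sum_distrib_right)
  finally show ?thesis using coord_flip_opp[OF assms] by (simp add: algebra_simps)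
qed

text \<open>This is \<open>-K . C\<close> at least 1: the opposite vertex lies outside
  \<open>B\<close> and so has height at most 0.\<close>

lemma wt_le_1: "B \<in> \<B> \<Longrightarrow> v \<in> B \<Longrightarrow> wt B v \<le> 1"
  using wt_eq[of B v] opp[of B v] ht_nonpos[of B "flip B v" "opp B v"] by (simp add: flip_def)

text \<open>If \<open>w\<close> has a negative coordinate at \<open>v\<close>, crossing the ridge opposite to \<open>v\<close> raises its height.\<close>

lemma ht_0_imp_opp:
  assumes B: "B \<in> \<B>" and w: "w \<in> vertices" "ht B w = 0"
  shows "w \<in> opp B ` B"
proof -
  obtain v where v: "v \<in> B" "coord B v w < 0"
    using nonneg_ht_0[OF B, of w] w zero_notin_vertices by force
  have "coord B v w \<in> \<int>" using coord_Ints B v w vertices_in_lattice by auto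
  then have "coord B v w \<le> - 1" using v by (auto elim!: Ints_cases)
  then have "0 < coord B v w * (wt B v - 2)"
    using wt_le_1[OF B v(1)] by (intro mult_neg_neg) auto
  then have "0 < ht (flip B v) w" using ht_flip[OF B v(1), of w] w(2) by simp
  moreover obtain C where "C \<in> \<B>" "w \<in> C" using w unfolding vertices_def by auto
  ultimately have "w \<in> flip B v" using ht_nonpos[OF opp(2)[OF B v(1)]] by (meson not_less)
  moreover have "w \<notin> B" using ht_basis[OF B] w(2) by force
  ultimately show ?thesis using v unfolding flip_def by auto
qed

text \<open>Vertices have integral heights: 1 on \<open>B\<close>, 0 on \<open>Z\<close>, at most
  \<open>- 1\<close> on \<open>N\<close>. Those of height 0 are opposite vertices by
  \<open>ht_0_imp_opp\<close>, hence at most as many as there are ridges of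
  \<open>B\<close>.\<close>

lemma vertex_heights:
  assumes B: "B \<in> \<B>"
  defines "Z \<equiv> {w \<in> vertices. ht B w = 0}" and "N \<equiv> {w \<in> vertices. ht B w < 0}"
  shows "card vertices = CARD('n) + card Z + card N"
    and "Z \<subseteq> opp B ` B"
    and "card Z \<le> CARD('n)"
    and "(\<Sum>w\<in>vertices. ht B w) \<le> real CARD('n) - real (card N)"
proof -
  have BV: "B \<subseteq> vertices" using B unfolding vertices_def by auto
  have "ht B w \<le> 0" if "w \<in> vertices" "w \<notin> B" for w
    using ht_nonpos[OF B] that unfolding vertices_def by auto
  then have split: "vertices = B \<union> (Z \<union> N)" using BV unfolding Z_def N_def by force
  have fin: "finite B" "finite Z" "finite N" using finite_vertices finite_B B unfolding Z_def N_def by auto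
  have disj: "B \<inter> (Z \<union> N) = {}" "Z \<inter> N = {}" using ht_basis[OF B] unfolding Z_def N_def by force+
  show "card vertices = CARD('n) + card Z + card N"
    unfolding split using fin disj card_B[OF B] by (simp add: card_Un_disjoint)
  show sub: "Z \<subseteq> opp B ` B" using ht_0_imp_opp[OF B] unfolding Z_def by auto
  show "card Z \<le> CARD('n)"
    using card_mono[OF _ sub] card_image_le[OF fin(1), of "opp B"] fin card_B[OF B] by simp
  have "(\<Sum>w\<in>vertices. ht B w) = (\<Sum>w\<in>B. ht B w) + ((\<Sum>w\<in>Z. ht B w) + (\<Sum>w\<in>N. ht B w))"
    unfolding split using fin disj by (simp add: sum.union_disjoint)
  moreover have "(\<Sum>w\<in>B. ht B w) = real CARD('n)" using ht_basis[OF B] card_B[OF B] by simp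
  moreover have "(\<Sum>w\<in>Z. ht B w) = 0" unfolding Z_def by simp
  moreover have "(\<Sum>w\<in>N. ht B w) \<le> (\<Sum>w\<in>N. - 1)"
  proof (rule sum_mono)
    fix w assume w: "w \<in> N"
    then have "ht B w \<in> \<int>" using ht_Ints[OF B] vertices_in_lattice unfolding N_def by auto
    then show "ht B w \<le> - 1" using w unfolding N_def by (auto elim!: Ints_cases)
  qed
  ultimately show "(\<Sum>w\<in>vertices. ht B w) \<le> real CARD('n) - real (card N)" by simp
qed

text \<open>Over a facet whose cone contains the sum of all vertices, the heights add up to a
  nonnegative number. The vertices of negative height are then at most as many as those of height 1,
  and \<open>Z\<close> adds at most the dimension again.\<close>

lemma card_vertices_le: "card vertices \<le> 3 * CARD('n)"
  and card_vertices_extremal: "card vertices = 3 * CARD('n) \<Longrightarrow> B \<in> \<B> \<Longrightarrow> v \<in> B \<Longrightarrow> wt B v = 1"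
proof -
  define s where "s = \<Sum>vertices"
  have hs: "(\<Sum>w\<in>vertices. ht B w) = ht B s" if "B \<in> \<B>" for B
    unfolding s_def using that by (simp add: ht_sum)
  obtain C where C: "C \<in> \<B>" "\<And>v. v \<in> C \<Longrightarrow> 0 \<le> coord C v s" using covering by blast
  have "0 \<le> ht C s" unfolding ht_def using C by (intro sum_nonneg) auto
  then show "card vertices \<le> 3 * CARD('n)"
    using vertex_heights(1,3,4)[OF C(1)] hs[OF C(1)] by linarith
  \<comment> \<open>In the extremal case the vertices sum to zero, so every facet qualifies as the special one.\<close>
  assume ext: "card vertices = 3 * CARD('n)" and B: "B \<in> \<B>" and v: "v \<in> B"
  have "ht C s \<le> 0" using vertex_heights(1,3,4)[OF C(1)] hs[OF C(1)] ext by linarith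
  then have "s = 0" using nonneg_ht_0 C by blast
  then have "CARD('n) \<le> card {w \<in> vertices. ht B w = 0}"
    using vertex_heights(1,4)[OF B] hs[OF B, unfolded \<open>s = 0\<close> ht_zero[OF B]] ext by linarith
  moreover have "card (opp B ` B) \<le> CARD('n)"
    using card_image_le[OF finite_B[OF B], of "opp B"] card_B[OF B] by simp
  ultimately have "{w \<in> vertices. ht B w = 0} = opp B ` B"
    using vertex_heights(2)[OF B] finite_B[OF B] by (intro card_seteq) auto
  then have "ht B (opp B v) = 0" using v by blast
  then show "wt B v = 1" using wt_eq[OF B v] by simp
qed

theorem hvec_properties:
  obtains h :: "nat \<Rightarrow> nat" where
    "\<And>m. card (lattice_points m) = (\<Sum>i\<le>CARD('n). h i * ((m + CARD('n) - i) choose CARD('n)))"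
    "h 0 = 1" "\<And>i. i \<le> CARD('n) \<Longrightarrow> h (CARD('n) - i) = h i"
    "h 1 \<le> 2 * CARD('n)"
    "card (lattice_points 2) \<le> 1 + 2 * (h 1 + CARD('n)) + ((h 1 + CARD('n)) choose 2)"
    "0 \<le> (\<Sum>i\<le>CARD('n). real (h i) * (3 * (real CARD('n) - 2 * real i)\<^sup>2 - 2 * real CARD('n)))"
    "h 1 = 2 * CARD('n) \<Longrightarrow> 
      (\<Sum>i\<le>CARD('n). real (h i) * (3 * (real CARD('n) - 2 * real i)\<^sup>2 - 2 * real CARD('n))) = 0"
proof -
  let ?d = "CARD('n)"
  obtain x where x: "off_walls x" and
    tot: "total_wt = - 3 * (\<Sum>i\<le>?d. real (hvec x i) * ((real ?d - 2 * real i)\<^sup>2 - real ?d))"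
    using total_wt_eq .
  let ?h = "hvec x"
  \<comment> \<open>At \<open>m = 1\<close> only \<open>h 0\<close> and \<open>h 1\<close> survive,
    with coefficients \<open>d + 1\<close> and 1; this identifies \<open>h 1\<close> with the number
    of vertices minus \<open>d\<close>.\<close>
  have "card (lattice_points 1) = (\<Sum>i\<le>?d. ?h i * ((1 + ?d - i) choose ?d))"
    by (rule card_lattice_points_hvec[OF x])
  also have "\<dots> = (\<Sum>i\<le>1. ?h i * ((1 + ?d - i) choose ?d))"
    using zero_less_card_finite[where 'a = 'n]
    by (intro sum.mono_neutral_right) (auto simp: not_le intro!: binomial_eq_0)
  also have "\<dots> = ?d + 1 + ?h 1" using hvec_0[OF x] by simp
  finally have n: "card vertices = ?h 1 + ?d" using card_lattice_points_1 by simp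
  have cards: "(\<Sum>B\<in>\<B>. \<Sum>v\<in>B. 1 :: real) = real ?d * (\<Sum>i\<le>?d. real (?h i))"
    using sum_neg[where g = "\<lambda>_. 1 :: real" and x = x] card_B by simp
  \<comment> \<open>The sum of \<open>1 - wt\<close> over all flags: the weights give
    \<open>3 * ((d - 2 i)^2 - d)\<close> and the number of flags adds \<open>d\<close>. It is
    nonnegative by \<open>wt_le_1\<close> and vanishes when there are \<open>3 * d\<close>
    vertices.\<close>
  have eq: "(\<Sum>i\<le>?d. real (?h i) * (3 * (real ?d - 2 * real i)\<^sup>2 - 2 * real ?d)) = (\<Sum>B\<in>\<B>. \<Sum>v\<in>B. 1 - wt B v)"
  proof -
    have "(\<Sum>i\<le>?d. real (?h i) * (3 * (real ?d - 2 * real i)\<^sup>2 - 2 * real ?d)) = 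
      (\<Sum>i\<le>?d. 3 * (real (?h i) * ((real ?d - 2 * real i)\<^sup>2 - real ?d)) + real ?d * real (?h i))"
      by (intro sum.cong refl) (simp add: algebra_simps)
    also have "\<dots> = 3 * (\<Sum>i\<le>?d. real (?h i) * ((real ?d - 2 * real i)\<^sup>2 - real ?d)) + real ?d * (\<Sum>i\<le>?d. real (?h i))"
      by (simp only: sum.distrib sum_distrib_left)
    also have "\<dots> = (\<Sum>B\<in>\<B>. \<Sum>v\<in>B. 1 :: real) - total_wt"
      unfolding tot cards by simp
    finally show ?thesis by (simp only: total_wt_def sum_subtractf)
  qed
  show ?thesis
  proof (rule that[of ?h])
    show "card (lattice_points m) = (\<Sum>i\<le>?d. ?h i * ((m + ?d - i) choose ?d))" for m
      by (rule card_lattice_points_hvec[OF x])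
    show "?h 0 = 1" by (rule hvec_0[OF x])
    show "i \<le> ?d \<Longrightarrow> ?h (?d - i) = ?h i" for i by (rule hvec_symmetric[OF x])
    show "?h 1 \<le> 2 * ?d" using n card_vertices_le by simp
    show "card (lattice_points 2) \<le> 1 + 2 * (?h 1 + ?d) + ((?h 1 + ?d) choose 2)"
      using card_lattice_points_2 n by simp
    show "0 \<le> (\<Sum>i\<le>?d. real (?h i) * (3 * (real ?d - 2 * real i)\<^sup>2 - 2 * real ?d))"
      unfolding eq using wt_le_1 by (intro sum_nonneg) auto
    show "(\<Sum>i\<le>?d. real (?h i) * (3 * (real ?d - 2 * real i)\<^sup>2 - 2 * real ?d)) = 0" if "?h 1 = 2 * ?d"
      unfolding eq using card_vertices_extremal n that by simp
  qed
qed

end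

section \<open>Facets of a smooth polytope\<close>

text \<open>Integer independence gives real independence because the integer coordinate functions extend to
  the linear functions \<open>p b\<close>.\<close>

lemma lattice_basis_properties:
  fixes B :: "(real ^ 'n) set"
  assumes "lattice_basis B" "finite B"
  shows "independent B" "span B = UNIV" "B \<subseteq> integer_lattice"
    and "b \<in> B \<Longrightarrow> y \<in> integer_lattice \<Longrightarrow> representation B y b \<in> \<int>"
proof -
  have ind: "int_module.independent B" and sp: "int_module.span B = integer_lattice"
    using assms unfolding lattice_basis_def by auto
  let ?R = "int_module.representation B"
  let ?e = "\<lambda>i. axis i 1 :: real ^ 'n"
  define p :: "real ^ 'n \<Rightarrow> real ^ 'n \<Rightarrow> real" where
    "p b y = (\<Sum>i\<in>UNIV. y $ i * of_int (?R (?e i) b))" for b y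
  have e: "?e i \<in> integer_lattice" for i unfolding integer_lattice_def axis_def by auto
  show lat: "B \<subseteq> integer_lattice" using int_module.span_superset[of B] sp by simp
  have p_lattice: "p b y = of_int (?R y b)" if "y \<in> integer_lattice" for b y
  proof -
    have y: "y $ i = of_int \<lfloor>y $ i\<rfloor>" for i
    proof -
      have "y $ i \<in> \<int>" using that by (simp add: integer_lattice_def)
      then show ?thesis by (auto elim: Ints_cases)
    qed
    have "y = (\<Sum>i\<in>UNIV. of_int \<lfloor>y $ i\<rfloor> *\<^sub>R ?e i)"
      using basis_expansion[of y] by (simp add: scalar_mult_eq_scaleR flip: y)
    then have "?R y b = ?R (\<Sum>i\<in>UNIV. of_int \<lfloor>y $ i\<rfloor> *\<^sub>R ?e i) b" by simp
    also have "\<dots> = (\<Sum>i\<in>UNIV. \<lfloor>y $ i\<rfloor> * ?R (?e i) b)"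
      using ind e sp by (subst int_module.representation_sum) 
        (auto simp: int_module.representation_scale intro: lattice_scale)
    finally show ?thesis unfolding p_def by (simp add: y[symmetric])
  qed
  have lin: "linear (p b)" for b
    unfolding p_def by (rule linearI) (simp_all add: sum.distrib algebra_simps sum_distrib_left)
  have dual: "p b b' = (if b = b' then 1 else 0)" if "b' \<in> B" for b b'
  proof -
    have "b' \<in> integer_lattice" using lat that by auto
    then show ?thesis using that ind by (simp add: p_lattice int_module.representation_basis)
  qed
  have psum: "p b (\<Sum>v\<in>B. c v *\<^sub>R v) = c b" if "b \<in> B" for b c
  proof -
    have "p b (\<Sum>v\<in>B. c v *\<^sub>R v) = (\<Sum>v\<in>B. if b = v then c b else 0)"
      unfolding linear_sum[OF lin] linear_cmul[OF lin] using dual by (intro sum.cong) auto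
    then show ?thesis using that assms(2) by simp
  qed
  show indep: "independent B"
    unfolding dependent_finite[OF assms(2)] using psum linear_0[OF lin] by metis
  have "?e i \<in> span B" for i
  proof -
    have "(\<Sum>b\<in>B. of_int (?R (?e i) b) *\<^sub>R b) = ?e i"
      using ind e sp assms(2) by (intro int_module.sum_representation_eq) auto
    then show ?thesis by (metis (no_types, lifting) span_base span_scale span_sum)
  qed
  then have "(\<Sum>i\<in>UNIV. y $ i *\<^sub>R ?e i) \<in> span B" for y :: "real ^ 'n"
    by (intro span_sum span_scale)
  then have "y \<in> span B" for y
    by (subst basis_expansion[of y, unfolded scalar_mult_eq_scaleR, symmetric])
  then show span: "span B = UNIV" by blast
  show "representation B y b \<in> \<int>" if "b \<in> B" "y \<in> integer_lattice"
  proof -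
    have "(\<Sum>v\<in>B. representation B y v *\<^sub>R v) = y"
      using indep span assms(2) by (intro real_vector.sum_representation_eq) auto
    then have "representation B y b = p b y" using psum[OF that(1)] by metis
    then show ?thesis using p_lattice[OF that(2)] by simp
  qed
qed

definition facet_vertices :: "(real ^ 'n) set \<Rightarrow> (real ^ 'n) set set" where
  "facet_vertices P = (\<lambda>F. {v. v extreme_point_of F}) ` {F. F facet_of P}"

context
  fixes P :: "(real ^ 'n) set"
  assumes smooth: "smooth_polytope P"
begin

lemma polytope_P: "polytope P" 
  using smooth unfolding smooth_polytope_def lattice_polytope_def polytope_def by blast

lemma interior_P: "0 \<in> interior P"
  using smooth unfolding smooth_polytope_def by blast

text \<open>The origin is interior, so the right-hand side of the facet inequality is positive and
  can be scaled to 1.\<close>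

lemma facet_hyperplane:
  assumes "F facet_of P"
  obtains a where "P \<subseteq> {x. a \<bullet> x \<le> 1}" "F = P \<inter> {x. a \<bullet> x = 1}"
proof -
  obtain a b where ab: "P \<subseteq> {x. a \<bullet> x \<le> b}" "F = P \<inter> {x. a \<bullet> x = b}"
  proof -
    have "F exposed_face_of P"
      using assms polytope_P facet_of_imp_face_of exposed_face_of_polyhedron polytope_imp_polyhedron by blast
    then show thesis using that unfolding exposed_face_of_def by blast
  qed
  have "F face_of P" "F \<noteq> P"
    using assms facet_of_imp_face_of facet_of_irrefl by blast+
  then have "0 \<notin> F" using face_of_disjoint_interior interior_P by blast
  moreover have "0 \<in> P" using interior_P interior_subset by blast
  ultimately have "b > 0" using ab by force
  show ?thesis
    by (rule that[of "inverse b *\<^sub>R a"]) (use ab \<open>b > 0\<close> in \<open>auto simp: field_simps\<close>)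
qed

lemma facet_basis:
  assumes "F facet_of P"
  shows "finite {v. v extreme_point_of F}" "lattice_basis {v. v extreme_point_of F}"
    and "F = convex hull {v. v extreme_point_of F}"
proof -
  have "polytope F" using assms polytope_P facet_of_imp_face_of face_of_polytope_polytope by blast
  then show "finite {v. v extreme_point_of F}"
    by (intro finite_polyhedron_extreme_points polytope_imp_polyhedron)
  show "F = convex hull {v. v extreme_point_of F}"
    using \<open>polytope F\<close> by (intro Krein_Milman_Minkowski polytope_imp_compact polytope_imp_convex)
  show "lattice_basis {v. v extreme_point_of F}" using smooth assms unfolding smooth_polytope_def by blast
qed

lemma facet_ht:
  assumes "F facet_of P" "P \<subseteq> {x. a \<bullet> x \<le> 1}" "F = P \<inter> {x. a \<bullet> x = 1}"
  shows "ht {v. v extreme_point_of F} y = a \<bullet> y"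
proof -
  let ?B = "{v. v extreme_point_of F}"
  have v: "a \<bullet> v = 1" if "v \<in> ?B" for v using that assms(3) unfolding extreme_point_of_def by auto
  have "(\<Sum>v\<in>?B. representation ?B y v *\<^sub>R v) = y"
    using lattice_basis_properties[OF facet_basis(2,1)[OF assms(1)]] facet_basis(1)[OF assms(1)]
    by (intro real_vector.sum_representation_eq) auto
  then have "a \<bullet> y = a \<bullet> (\<Sum>v\<in>?B. representation ?B y v *\<^sub>R v)" by simp
  also have "\<dots> = (\<Sum>v\<in>?B. representation ?B y v)" using v by (simp add: inner_sum_right)
  finally show ?thesis by (simp add: ht_def coord_def)
qed

text \<open>The ray from the origin through \<open>y\<close> leaves the polytope in a point of some
  facet, which is a convex combination of the vertices of that facet.\<close>

lemma facets_cover: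
  "\<exists>F. F facet_of P \<and> (\<forall>v\<in>{v. v extreme_point_of F}. 0 \<le> coord {v. v extreme_point_of F} v y)"
proof -
  have ray: "\<exists>F t. F facet_of P \<and> t > 0 \<and> t *\<^sub>R l \<in> F" if l: "l \<noteq> 0" for l
  proof -
    obtain t where t: "0 < t" "0 + t *\<^sub>R l \<in> frontier P"
      by (rule ray_to_frontier[OF polytope_imp_bounded[OF polytope_P] interior_P l])
    have "frontier P = P - rel_interior P"
      using interior_P polytope_imp_closed[OF polytope_P] rel_interior_nonempty_interior[of P]
      unfolding frontier_def by auto
    then have "0 + t *\<^sub>R l \<in> \<Union> {F. F facet_of P}"
      using t(2) rel_boundary_of_polyhedron[OF polytope_imp_polyhedron[OF polytope_P]] by simp
    then show ?thesis using t(1) by auto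
  qed
  \<comment> \<open>For \<open>y = 0\<close> any direction will do, since only the existence of some
    facet is at stake.\<close>
  define l :: "real ^ 'n" where "l = (if y = 0 then axis undefined 1 else y)"
  have "l \<noteq> 0" unfolding l_def by (auto simp: axis_eq_0_iff)
  then obtain F t where F: "F facet_of P" "t > 0" "t *\<^sub>R l \<in> F" using ray by blast
  let ?B = "{v. v extreme_point_of F}"
  note b = lattice_basis_properties[OF facet_basis(2,1)[OF F(1)]]
  have ls: "linear (\<lambda>y. representation ?B y v)" for v
    by (rule linearI) (simp_all add: representation_add[OF b(1)] representation_scale[OF b(1)] b(2))
  obtain u where u: "\<And>v. v \<in> ?B \<Longrightarrow> 0 \<le> u v" "(\<Sum>v\<in>?B. u v *\<^sub>R v) = t *\<^sub>R l"
  proof -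
    have "t *\<^sub>R l \<in> convex hull ?B" using F facet_basis(3) by simp
    then show thesis using that facet_basis(1)[OF F(1)] by (auto simp: convex_hull_finite)
  qed
  have "0 \<le> coord ?B v y" if v: "v \<in> ?B" for v
  proof (cases "y = 0")
    case True
    then show ?thesis using linear_0[OF ls] by (simp add: coord_def)
  next
    case False
    have "t * representation ?B y v = representation ?B (\<Sum>w\<in>?B. u w *\<^sub>R w) v"
      unfolding u(2) linear_cmul[OF ls] using False by (simp add: l_def)
    also have "\<dots> = (\<Sum>w\<in>?B. if w = v then u v else 0)"
      unfolding linear_sum[OF ls] linear_cmul[OF ls]
      using b(1) by (intro sum.cong) (auto simp: representation_basis)
    also have "\<dots> = u v" using v facet_basis(1)[OF F(1)] by simp
    finally have "0 \<le> t * representation ?B y v" using u(1)[OF v] by simp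
    then show ?thesis using F(2) by (simp add: coord_def zero_le_mult_iff)
  qed
  then show ?thesis using F(1) by blast
qed

text \<open>The height bound comes from integrality: a vertex off the facet lies strictly below the
  hyperplane at height 1, and its height is an integer.\<close>

lemma smooth_fano_facet_vertices: "smooth_fano (facet_vertices P)"
proof
  show "finite (facet_vertices P)"
    unfolding facet_vertices_def using finite_polytope_facets[OF polytope_P] by simp
  show "\<exists>B\<in>facet_vertices P. \<forall>v\<in>B. 0 \<le> coord B v y" for y
    using facets_cover[of y] unfolding facet_vertices_def by blast
next
  fix B assume "B \<in> facet_vertices P"
  then obtain F where F: "F facet_of P" "B = {v. v extreme_point_of F}" unfolding facet_vertices_def by auto
  note b = lattice_basis_properties[OF facet_basis(2,1)[OF F(1)], folded F(2)]
  show "independent B" "span B = UNIV" "B \<subseteq> integer_lattice" by (fact b)+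
  show ints: "coord B v y \<in> \<int>" if "v \<in> B" "y \<in> integer_lattice" for v y
    unfolding coord_def using b(4) that .
  fix C w assume C: "C \<in> facet_vertices P" and w: "w \<in> C" "w \<notin> B"
  obtain G where G: "G facet_of P" "C = {v. v extreme_point_of G}" using C unfolding facet_vertices_def by auto
  have wP: "w extreme_point_of P"
    using w G facet_of_imp_face_of extreme_point_of_face by blast
  obtain a where a: "P \<subseteq> {x. a \<bullet> x \<le> 1}" "F = P \<inter> {x. a \<bullet> x = 1}" using facet_hyperplane[OF F(1)] .
  have ht: "ht B w = a \<bullet> w" unfolding F(2) by (rule facet_ht[OF F(1) a])
  have "w \<notin> F" using w(2) wP F facet_of_imp_face_of extreme_point_of_face by blast
  moreover have "w \<in> P" using wP unfolding extreme_point_of_def by simp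
  ultimately have "ht B w < 1" using a ht by force
  moreover have "w \<in> integer_lattice"
    using lattice_basis_properties(3)[OF facet_basis(2,1)[OF G(1)]] w G(2) by blast
  then have "ht B w \<in> \<int>" unfolding ht_def using ints by (intro Ints_sum) auto
  ultimately show "ht B w \<le> 0" by (auto elim!: Ints_cases)
qed

lemma ehrhart_count_eq: "ehrhart_count P m = card (smooth_fano.lattice_points (facet_vertices P) m)"
proof -
  interpret smooth_fano "facet_vertices P" by (rule smooth_fano_facet_vertices)
  have 0: "0 \<in> P" using interior_P interior_subset by blast
  have conv: "convex P" using polytope_imp_convex[OF polytope_P] .
  have "(\<lambda>x. real m *\<^sub>R x) ` P \<inter> integer_lattice = lattice_points m"
  proof (intro equalityI subsetI)
    fix y assume "y \<in> (\<lambda>x. real m *\<^sub>R x) ` P \<inter> integer_lattice"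
    then obtain x where x: "x \<in> P" "y = real m *\<^sub>R x" and y: "y \<in> integer_lattice" by auto
    obtain F where F: "F facet_of P" and pos: "\<forall>v\<in>{v. v extreme_point_of F}. 0 \<le> coord {v. v extreme_point_of F} v y"
      using facets_cover by blast
    obtain a where a: "P \<subseteq> {x. a \<bullet> x \<le> 1}" "F = P \<inter> {x. a \<bullet> x = 1}" using facet_hyperplane[OF F] .
    have "ht {v. v extreme_point_of F} y = real m * (a \<bullet> x)" using facet_ht[OF F a] x by simp
    also have "\<dots> \<le> real m * 1" using a x by (intro mult_left_mono) auto
    finally have "ht {v. v extreme_point_of F} y \<le> real m" by simp
    moreover have "{v. v extreme_point_of F} \<in> facet_vertices P"
      unfolding facet_vertices_def using F by blast
    ultimately show "y \<in> lattice_points m"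
      unfolding lattice_points_def using y pos by blast
  next
    fix y assume "y \<in> lattice_points m"
    then obtain B where B: "B \<in> facet_vertices P" "\<And>v. v \<in> B \<Longrightarrow> 0 \<le> coord B v y" "ht B y \<le> real m"
      and y: "y \<in> integer_lattice" unfolding lattice_points_def by blast
    show "y \<in> (\<lambda>x. real m *\<^sub>R x) ` P \<inter> integer_lattice"
    proof (cases "m = 0")
      case True
      then have "y = 0" using nonneg_ht_0[OF B(1,2)] B(3) by simp
      then show ?thesis using 0 y by (auto intro!: image_eqI[of _ _ 0])
    next
      case False
      have BP: "B \<subseteq> P" using B(1) facet_of_imp_subset unfolding facet_vertices_def extreme_point_of_def by blast
      have 0: "0 \<notin> B" using indep[OF B(1)] dependent_zero by blast
      \<comment> \<open>The weight that \<open>y / m\<close> leaves over goes to the origin, which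
        turns the conical combination into a convex one.\<close>
      define c where "c v = (if v = 0 then 1 - ht B y / m else coord B v y / m)" for v
      have "(\<Sum>v\<in>B. c v) = (\<Sum>v\<in>B. coord B v y / m)" using 0 unfolding c_def by (intro sum.cong) auto
      also have "\<dots> = ht B y / m" by (simp add: ht_def sum_divide_distrib)
      finally have c1: "(\<Sum>v\<in>insert 0 B. c v) = 1" using finite_B[OF B(1)] 0 by (simp add: c_def)
      have in_P: "(\<Sum>v\<in>insert 0 B. c v *\<^sub>R v) \<in> P"
      proof (rule convex_sum[OF _ conv c1])
        show "0 \<le> c v" if "v \<in> insert 0 B" for v
          using that B(2)[of v] B(3) False unfolding c_def by (auto simp: field_simps)
        show "v \<in> P" if "v \<in> insert 0 B" for v using that BP \<open>0 \<in> P\<close> by auto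
      qed (use finite_B[OF B(1)] in auto)
      have "real m *\<^sub>R (\<Sum>v\<in>insert 0 B. c v *\<^sub>R v) = y"
      proof -
        have "real m *\<^sub>R (\<Sum>v\<in>insert 0 B. c v *\<^sub>R v) = (\<Sum>v\<in>B. (real m * c v) *\<^sub>R v)"
          using finite_B[OF B(1)] 0 by (simp add: scaleR_sum_right)
        also have "\<dots> = (\<Sum>v\<in>B. coord B v y *\<^sub>R v)" using 0 False unfolding c_def by (intro sum.cong) auto
        finally show ?thesis using coord_expand[OF B(1)] by simp
      qed
      then show ?thesis using y in_P by (intro IntI image_eqI[OF _ in_P]) simp_all
    qed
  qed
  then show ?thesis unfolding ehrhart_count_def by simp
qed

end

section \<open>Roots in dimension at most five\<close>

lemma poly_eq_on_nat:
  fixes p q :: "complex poly"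
  assumes "\<And>m :: nat. poly p (of_nat m) = poly q (of_nat m)" shows "p = q"
proof (rule ccontr)
  assume "p \<noteq> q"
  then have "finite {x. poly (p - q) x = 0}" by (intro poly_roots_finite) simp
  moreover have "range (of_nat :: nat \<Rightarrow> complex) \<subseteq> {x. poly (p - q) x = 0}" using assms by auto
  moreover have "infinite (range (of_nat :: nat \<Rightarrow> complex))"
    by (simp add: finite_image_iff inj_of_nat)
  ultimately show False using finite_subset by blast
qed

lemma ehrhart_poly_eqI:
  assumes "\<And>m. poly p (of_nat m) = of_nat (ehrhart_count P m)" shows "ehrhart_poly P = p"
  unfolding ehrhart_poly_def using assms poly_eq_on_nat by (intro the_equality) simp_all

text \<open>The square of \<open>z + 1/2\<close> is real and at most 0, so \<open>z + 1/2\<close> is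
  purely imaginary.\<close>

lemma critical_line:
  fixes z :: complex
  assumes "z\<^sup>2 + z = of_real r" "r \<le> - 1 / 4" shows "Re z = - 1 / 2"
proof -
  have re: "(Re z)\<^sup>2 - (Im z)\<^sup>2 + Re z = r" and im: "Im z * (2 * Re z + 1) = 0"
    using assms(1) by (auto simp: complex_eq_iff power2_eq_square algebra_simps)
  show ?thesis
  proof (cases "Im z = 0")
    case True
    then have "(Re z + 1 / 2)\<^sup>2 \<le> 0" using re assms(2) by (simp add: power2_eq_square algebra_simps)
    then show ?thesis by simp
  next
    case False
    then show ?thesis using im by simp
  qed
qed

text \<open>The third hypothesis is a nonnegative discriminant. The last two say that the vertex of
  the parabola lies at or left of - 1/4 and that its value at - 1/4 is nonnegative, so both roots
  lie at or left of - 1/4.\<close>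

lemma real_quadratic_roots:
  fixes y :: complex and a b :: real
  assumes "of_real a * y\<^sup>2 + of_real b * y + 1 = 0" "a > 0" "4 * a \<le> b\<^sup>2" "a / 2 \<le> b" "b \<le> 4 + a / 4"
  obtains r where "y = of_real r" "r \<le> - 1 / 4"
proof -
  define p q where "p = Re y" and "q = Im y"
  have y: "y = Complex p q" by (simp add: p_def q_def)
  have re: "a * (p\<^sup>2 - q\<^sup>2) + b * p + 1 = 0" and im: "q * (2 * a * p + b) = 0"
    using assms(1) unfolding y by (auto simp: complex_eq_iff power2_eq_square algebra_simps)
  have q: "q = 0"
  proof (rule ccontr)
    assume q: "q \<noteq> 0"
    then have "2 * a * p + b = 0" using im by simp
    then have p: "b = - 2 * a * p" by linarith
    \<comment> \<open>For a non-real root the product of the two conjugate roots is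
      \<open>1 / a\<close>, while the discriminant condition already gives
      \<open>1 \<le> a * p\<^sup>2\<close>.\<close>
    have "a * (p\<^sup>2 + q\<^sup>2) = 1" using re unfolding p by (simp add: power2_eq_square algebra_simps)
    moreover have "4 * a * 1 \<le> 4 * a * (a * p\<^sup>2)" using assms(3) unfolding p by (simp add: power2_eq_square algebra_simps)
    then have "1 \<le> a * p\<^sup>2" using assms(2) by (simp only: mult_le_cancel_left_pos)
    moreover have "0 < a * q\<^sup>2" using q assms(2) by simp
    ultimately show False by (simp add: distrib_left)
  qed
  have "p \<le> - 1 / 4"
  proof (rule ccontr)
    assume "\<not> ?thesis"
    then have p: "0 < p + 1 / 4" by simp
    then have "- (a / 2) < a * (p - 1 / 4)" using assms(2) mult_strict_left_mono[of "- 1 / 2" "p - 1 / 4" a] by simp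
    then have "0 < (p + 1 / 4) * (a * (p - 1 / 4) + b)" using assms(4) p by (intro mult_pos_pos) auto
    \<comment> \<open>The difference between the values of the quadratic at \<open>p\<close> and at
      - 1/4.\<close>
    also have "\<dots> = (a * (p\<^sup>2 - q\<^sup>2) + b * p + 1) - (a / 16 - b / 4 + 1)"
      unfolding q by (simp add: power2_eq_square algebra_simps)
    finally show False using assms(5) re by simp
  qed
  then show ?thesis using that[of p] y q by (simp add: complex_eq_iff)
qed

lemma quadratic_critical_line:
  fixes z :: complex and a b :: real
  assumes "of_real a * (z\<^sup>2 + z)\<^sup>2 + of_real b * (z\<^sup>2 + z) + 1 = 0"
    and "a > 0" "4 * a \<le> b\<^sup>2" "a / 2 \<le> b" "b \<le> 4 + a / 4"
  shows "Re z = - 1 / 2"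
  using real_quadratic_roots[OF assms] critical_line by metis

lemma linear_critical_line:
  fixes z :: complex and a :: real
  assumes "of_real a * (z\<^sup>2 + z) + 1 = 0" "0 < a" "a \<le> 4"
  shows "Re z = - 1 / 2"
proof (rule critical_line)
  show "z\<^sup>2 + z = of_real (- 1 / a)"
    using assms by (simp add: field_simps eq_neg_iff_add_eq_0)
  show "- 1 / a \<le> - 1 / 4" using assms by (simp add: field_simps)
qed

lemma linear_factor_root:
  fixes z :: complex assumes "1 + 2 * z = 0" shows "Re z = - 1 / 2"
proof -
  have "z = - 1 / 2" using assms by (simp add: field_simps eq_neg_iff_add_eq_0)
  then show ?thesis by simp
qed

section \<open>Numerical estimates and explicit polynomials in dimensions one to five\<close>

lemma of_nat_choose:
  "(of_nat (n choose k) :: complex) = (\<Prod>i<k. of_nat n - of_nat i) / fact k"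
  by (simp add: binomial_gbinomial gbinomial_prod_rev of_nat_gbinomial lessThan_atLeast0)

text \<open>The left side grows with \<open>F\<close> while the right side shrinks, so the
  discriminant condition may be checked at an upper bound for \<open>F\<close>.\<close>

lemma quadratic_mono:
  fixes F G c k :: int
  assumes "F \<le> G" "0 \<le> k" "2 * G \<le> c" "k * G \<le> (c - 2 * G)\<^sup>2"
  shows "k * F \<le> (c - 2 * F)\<^sup>2"
proof -
  have "k * F \<le> k * G" using assms by (intro mult_left_mono)
  also have "\<dots> \<le> (c - 2 * G)\<^sup>2" by fact
  also have "\<dots> \<le> (c - 2 * F)\<^sup>2" using assms by (intro power_mono) auto
  finally show ?thesis .
qed

text \<open>Here \<open>F\<close> is 24 times the leading coefficient in the variable
  \<open>m^2 + m\<close>. The discriminant condition uses the curve bound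
  \<open>F \<le> 3 * (int h1 + 4)\<close> when \<open>h1\<close> is at least 4, and the edge bound
  for the smaller values.\<close>

lemma h_bounds_4:
  fixes h1 h2 :: nat
  assumes "h1 \<le> 8" "h2 \<le> h1 + 10" "h1 = 8 \<Longrightarrow> h2 = h1 + 10"
    and "15 + 5 * h1 + h2 \<le> 1 + 2 * (h1 + 4) + ((h1 + 4) choose 2)"
  defines "F \<equiv> 2 + 2 * int h1 + int h2"
  shows "96 * F \<le> (12 * (int h1 + 4) - 2 * F)\<^sup>2"
    and "F \<le> 2 * (12 * (int h1 + 4) - 2 * F)"
    and "4 * (12 * (int h1 + 4) - 2 * F) \<le> 384 + F"
proof -
  have F: "F \<le> 3 * (int h1 + 4)" using assms(2) unfolding F_def by presburger
  then show "F \<le> 2 * (12 * (int h1 + 4) - 2 * F)" by simp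
  \<comment> \<open>Up to \<open>h1 = 7\<close> nonnegativity of \<open>h2\<close> suffices; for
    \<open>h1 = 8\<close> the exact value from the extremal case is used.\<close>
  show "4 * (12 * (int h1 + 4) - 2 * F) \<le> 384 + F"
    using assms(1,3) unfolding F_def by (cases "h1 = 8") auto
  show "96 * F \<le> (12 * (int h1 + 4) - 2 * F)\<^sup>2"
  proof (cases "4 \<le> h1")
    case True
    then have "8 * (int h1 + 4) \<le> (int h1 + 4) * (int h1 + 4)" by (intro mult_right_mono) auto
    then show ?thesis using F by (intro quadratic_mono[OF F]) (auto simp: power2_eq_square algebra_simps)
  next
    case False
    have bound: ?thesis if "int h1 = k" "F \<le> G" "2 * G \<le> 12 * (k + 4)" "96 * G \<le> (12 * (k + 4) - 2 * G)\<^sup>2" for k G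
      using that by (intro quadratic_mono[of F G]) auto
    have "h1 = 0 \<or> h1 = 1 \<or> h1 = 2 \<or> h1 = 3" using False by presburger
    then show ?thesis
    proof (elim disjE)
      assume h1: "h1 = 0"
      show ?thesis by (rule bound[of 0 2]) (use h1 assms(4) in \<open>auto simp: F_def choose_two\<close>)
    next
      assume h1: "h1 = 1"
      show ?thesis by (rule bound[of 1 5]) (use h1 assms(4) in \<open>auto simp: F_def choose_two\<close>)
    next
      assume h1: "h1 = 2"
      show ?thesis by (rule bound[of 2 9]) (use h1 assms(4) in \<open>auto simp: F_def choose_two\<close>)
    next
      assume h1: "h1 = 3"
      show ?thesis by (rule bound[of 3 14]) (use h1 assms(4) in \<open>auto simp: F_def choose_two\<close>)
    qed
  qed
qed

text \<open>The discriminant condition is checked at the largest admissible \<open>F\<close> for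
  each \<open>h1\<close>: the edge bound supplies it for \<open>h1\<close> up to 6, the curve bound
  from 7 on.\<close>

lemma h_bounds_5:
  fixes h1 h2 :: nat
  assumes "h1 \<le> 10" "7 * h2 \<le> 65 + 17 * h1"
    and "21 + 6 * h1 + h2 \<le> 1 + 2 * (h1 + 5) + ((h1 + 5) choose 2)"
  defines "F \<equiv> 1 + int h1 + int h2"
  shows "480 * F \<le> (20 * (int h1 + 3) - 2 * F)\<^sup>2"
    and "F \<le> 2 * (20 * (int h1 + 3) - 2 * F)"
    and "4 * (20 * (int h1 + 3) - 2 * F) \<le> 1920 + F"
proof -
  have F: "7 * F \<le> 24 * (int h1 + 3)" using assms(2) unfolding F_def by presburger
  then show "F \<le> 2 * (20 * (int h1 + 3) - 2 * F)" by simp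
  show "4 * (20 * (int h1 + 3) - 2 * F) \<le> 1920 + F"
    using assms(1) unfolding F_def by auto
  have bound: "480 * F \<le> (20 * (int h1 + 3) - 2 * F)\<^sup>2" if "int h1 = k" "F \<le> G" "2 * G \<le> 20 * (k + 3)" "480 * G \<le> (20 * (k + 3) - 2 * G)\<^sup>2" for k G
    using that by (intro quadratic_mono[of F G]) auto
  have "h1 = 0 \<or> h1 = 1 \<or> h1 = 2 \<or> h1 = 3 \<or> h1 = 4 \<or> h1 = 5 \<or> h1 = 6 \<or> h1 = 7 \<or> h1 = 8 \<or> h1 = 9 \<or> h1 = 10" using assms(1) by presburger
  then show "480 * F \<le> (20 * (int h1 + 3) - 2 * F)\<^sup>2"
  proof (elim disjE)
    assume h1: "h1 = 0"
    show ?thesis by (rule bound[of 0 1]) (use h1 F assms(3) in \<open>auto simp: F_def choose_two\<close>)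
  next
    assume h1: "h1 = 1"
    show ?thesis by (rule bound[of 1 3]) (use h1 F assms(3) in \<open>auto simp: F_def choose_two\<close>)
  next
    assume h1: "h1 = 2"
    show ?thesis by (rule bound[of 2 6]) (use h1 F assms(3) in \<open>auto simp: F_def choose_two\<close>)
  next
    assume h1: "h1 = 3"
    show ?thesis by (rule bound[of 3 10]) (use h1 F assms(3) in \<open>auto simp: F_def choose_two\<close>)
  next
    assume h1: "h1 = 4"
    show ?thesis by (rule bound[of 4 15]) (use h1 F assms(3) in \<open>auto simp: F_def choose_two\<close>)
  next
    assume h1: "h1 = 5"
    show ?thesis by (rule bound[of 5 21]) (use h1 F assms(3) in \<open>auto simp: F_def choose_two\<close>)
  next
    assume h1: "h1 = 6"
    show ?thesis by (rule bound[of 6 28]) (use h1 F assms(3) in \<open>auto simp: F_def choose_two\<close>)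
  next
    assume h1: "h1 = 7"
    show ?thesis by (rule bound[of 7 34]) (use h1 F assms(3) in \<open>auto simp: F_def choose_two\<close>)
  next
    assume h1: "h1 = 8"
    show ?thesis by (rule bound[of 8 37]) (use h1 F assms(3) in \<open>auto simp: F_def choose_two\<close>)
  next
    assume h1: "h1 = 9"
    show ?thesis by (rule bound[of 9 41]) (use h1 F assms(3) in \<open>auto simp: F_def choose_two\<close>)
  next
    assume h1: "h1 = 10"
    show ?thesis by (rule bound[of 10 44]) (use h1 F assms(3) in \<open>auto simp: F_def choose_two\<close>)
  qed
qed

lemma ehrhart_1:
  fixes h :: "nat \<Rightarrow> nat" and m :: nat
  assumes "h 0 = 1" "h 1 = 1"
  shows "(of_nat (\<Sum>i\<le>1. h i * ((m + 1 - i) choose 1)) :: complex) = 1 + 2 * of_nat m"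
  using assms by simp

text \<open>Palindromy makes the count symmetric under \<open>x\<close> to \<open>- 1 - x\<close> up
  to the sign \<open>(-1)^d\<close>. So in even dimension it is a polynomial in
  \<open>x^2 + x\<close>, and in odd dimension \<open>1 + 2 * x\<close> splits off; the constant
  term 1 is the count at 0.\<close>

lemma ehrhart_2:
  fixes h :: "nat \<Rightarrow> nat" and m :: nat
  assumes "h 0 = 1" "h 2 = 1"
  defines "x \<equiv> of_nat m :: complex"
  shows "of_nat (\<Sum>i\<le>2. h i * ((m + 2 - i) choose 2)) = of_real ((real (h 1) + 2) / 2) * (x\<^sup>2 + x) + 1"
  using assms by (simp add: of_nat_choose numeral_eq_Suc power2_eq_square field_simps)

lemma ehrhart_3:
  fixes h :: "nat \<Rightarrow> nat" and m :: nat
  assumes "h 0 = 1" "h 3 = 1" "h 2 = h 1"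
  defines "x \<equiv> of_nat m :: complex"
  shows "of_nat (\<Sum>i\<le>3. h i * ((m + 3 - i) choose 3)) = (1 + 2 * x) * (of_real ((1 + real (h 1)) / 6) * (x\<^sup>2 + x) + 1)"
  using assms by (simp add: of_nat_choose numeral_eq_Suc power2_eq_square field_simps)

lemma ehrhart_4:
  fixes h :: "nat \<Rightarrow> nat" and m :: nat
  assumes "h 0 = 1" "h 4 = 1" "h 3 = h 1"
  defines "x \<equiv> of_nat m :: complex" and "F \<equiv> 2 + 2 * real (h 1) + real (h 2)"
  shows "of_nat (\<Sum>i\<le>4. h i * ((m + 4 - i) choose 4)) =
    of_real (F / 24) * (x\<^sup>2 + x)\<^sup>2 + of_real ((12 * (real (h 1) + 4) - 2 * F) / 24) * (x\<^sup>2 + x) + 1"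
  using assms by (simp add: of_nat_choose numeral_eq_Suc power2_eq_square field_simps)

lemma ehrhart_5:
  fixes h :: "nat \<Rightarrow> nat" and m :: nat
  assumes "h 0 = 1" "h 5 = 1" "h 4 = h 1" "h 3 = h 2"
  defines "x \<equiv> of_nat m :: complex" and "F \<equiv> 1 + real (h 1) + real (h 2)"
  shows "of_nat (\<Sum>i\<le>5. h i * ((m + 5 - i) choose 5)) = (1 + 2 * x) *
    (of_real (F / 120) * (x\<^sup>2 + x)\<^sup>2 + of_real ((20 * (real (h 1) + 3) - 2 * F) / 120) * (x\<^sup>2 + x) + 1)"
  using assms by (simp add: of_nat_choose numeral_eq_Suc power2_eq_square field_simps)

text \<open>With the common denominator \<open>c\<close> cleared, the conditions become inequalities
  between integers, as the bounds on \<open>h\<close> supply them.\<close>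

lemma scaled_quadratic_critical_line:
  fixes F u c :: int and z :: complex
  assumes "of_real (of_int F / of_int c) * (z\<^sup>2 + z)\<^sup>2 + of_real (of_int u / of_int c) * (z\<^sup>2 + z) + 1 = 0"
    and "F > 0" "c > 0" "4 * c * F \<le> u\<^sup>2" "F \<le> 2 * u" "4 * u \<le> 16 * c + F"
  shows "Re z = - 1 / 2"
proof (rule quadratic_critical_line[OF assms(1)])
  have c: "real_of_int c > 0" using assms(3) by simp
  show "0 < real_of_int F / real_of_int c" using assms(2) c by simp
  have "real_of_int (4 * c * F) \<le> real_of_int (u\<^sup>2)" using assms(4) by (simp only: of_int_le_iff)
  then show "4 * (real_of_int F / real_of_int c) \<le> (real_of_int u / real_of_int c)\<^sup>2"
    using c by (simp add: field_simps power2_eq_square)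
  have "real_of_int F \<le> real_of_int (2 * u)" using assms(5) by (simp only: of_int_le_iff)
  then show "real_of_int F / real_of_int c / 2 \<le> real_of_int u / real_of_int c"
    using c by (simp add: field_simps)
  have "real_of_int (4 * u) \<le> real_of_int (16 * c + F)" using assms(6) by (simp only: of_int_le_iff)
  then show "real_of_int u / real_of_int c \<le> 4 + real_of_int F / real_of_int c / 4"
    using c by (simp add: field_simps)
qed

theorem theorem1p5:
  fixes P :: "(real ^ 'n) set" and z :: complex
  assumes "smooth_polytope P"
    and "CARD('n) \<le> 5"
    and "poly (ehrhart_poly P) z = 0"
  shows "Re z = - 1 / 2"
proof -
  let ?d = "CARD('n)"
  interpret smooth_fano "facet_vertices P" by (rule smooth_fano_facet_vertices[OF assms(1)])
  obtain h :: "nat \<Rightarrow> nat" where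
    L: "\<And>m. card (lattice_points m) = (\<Sum>i\<le>?d. h i * ((m + ?d - i) choose ?d))"
    and h0: "h 0 = 1" and sym: "\<And>i. i \<le> ?d \<Longrightarrow> h (?d - i) = h i"
    and h1: "h 1 \<le> 2 * ?d"
    and L2: "card (lattice_points 2) \<le> 1 + 2 * (h 1 + ?d) + ((h 1 + ?d) choose 2)"
    and ineq: "0 \<le> (\<Sum>i\<le>?d. real (h i) * (3 * (real ?d - 2 * real i)\<^sup>2 - 2 * real ?d))"
    and extremal: "h 1 = 2 * ?d \<Longrightarrow> 
      (\<Sum>i\<le>?d. real (h i) * (3 * (real ?d - 2 * real i)\<^sup>2 - 2 * real ?d)) = 0"
    by (rule hvec_properties) blast
  have count: "ehrhart_count P m = (\<Sum>i\<le>?d. h i * ((m + ?d - i) choose ?d))" for m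
    using ehrhart_count_eq[OF assms(1)] L by simp
  define Y :: "complex poly" where "Y = [:0, 1, 1:]"
  have Y: "poly Y x = x\<^sup>2 + x" for x by (simp add: Y_def power2_eq_square algebra_simps)
  define D :: "complex poly" where "D = [:1, 2:]"
  have D: "poly D x = 1 + 2 * x" for x by (simp add: D_def mult.commute)
  note ev = poly_add poly_mult poly_smult poly_power poly_1 Y D
  have hd: "h ?d = 1" using sym[of 0] h0 by simp
  have "?d \<noteq> 0" by simp
  then consider "?d = 1" | "?d = 2" | "?d = 3" | "?d = 4" | "?d = 5" using assms(2) by linarith
  then show ?thesis
  proof cases
    case 1
    have "ehrhart_poly P = D"
      by (rule ehrhart_poly_eqI) (unfold count 1 ev, rule ehrhart_1[symmetric], use h0 hd 1 in auto)
    then show ?thesis using assms(3) linear_factor_root[of z] by (simp add: D)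
  next
    case 2
    let ?a = "(real (h 1) + 2) / 2"
    have "ehrhart_poly P = smult (of_real ?a) Y + 1"
      by (rule ehrhart_poly_eqI) (unfold count 2 ev, rule ehrhart_2[symmetric], use h0 hd 2 in auto)
    then have "of_real ?a * (z\<^sup>2 + z) + 1 = 0" using assms(3) by (simp only: ev)
    then show ?thesis by (rule linear_critical_line) (use h1 2 in auto)
  next
    case 3
    let ?a = "(1 + real (h 1)) / 6"
    have h2: "h 2 = h 1" using sym[of 1] 3 by simp
    then have "ehrhart_poly P = D * (smult (of_real ?a) Y + 1)"
      by (intro ehrhart_poly_eqI) (unfold count 3 ev, rule ehrhart_3[symmetric], use h0 hd h2 3 in auto)
    then have "1 + 2 * z = 0 \<or> of_real ?a * (z\<^sup>2 + z) + 1 = 0"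
      using assms(3) by (simp only: ev mult_eq_0_iff)
    then show ?thesis
    proof
      assume "of_real ?a * (z\<^sup>2 + z) + 1 = 0"
      then show ?thesis by (rule linear_critical_line) (use h1 3 in auto)
    qed (rule linear_factor_root)
  next
    case 4
    define F where "F = 2 + 2 * int (h 1) + int (h 2)"
    let ?u = "12 * (int (h 1) + 4) - 2 * F"
    have h3: "h 3 = h 1" using sym[of 1] 4 by simp
    have F: "of_int F = 2 + 2 * real (h 1) + real (h 2)" "of_int ?u = 12 * (real (h 1) + 4) - 2 * of_int F"
      by (simp_all add: F_def)
    have "ehrhart_poly P = smult (of_real (of_int F / of_int 24)) (Y\<^sup>2) + smult (of_real (of_int ?u / of_int 24)) Y + 1"
      by (rule ehrhart_poly_eqI) (unfold count 4 ev F of_int_numeral, rule ehrhart_4[symmetric], use h0 hd h3 4 in auto)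
    then have root: "of_real (of_int F / of_int 24) * (z\<^sup>2 + z)\<^sup>2 + of_real (of_int ?u / of_int 24) * (z\<^sup>2 + z) + 1 = 0"
      using assms(3) by (simp only: ev)
    have L2': "15 + 5 * h 1 + h 2 \<le> 1 + 2 * (h 1 + 4) + ((h 1 + 4) choose 2)"
      using L2 h0 by (simp add: L 4 numeral_eq_Suc)
    \<comment> \<open>The weights for \<open>i = 0, ..., 4\<close> are 40, 4, -8, 4, 40.\<close>
    have S: "(\<Sum>i\<le>?d. real (h i) * (3 * (real ?d - 2 * real i)\<^sup>2 - 2 * real ?d)) = 8 * (real (h 1) + 10 - real (h 2))"
      using h0 hd h3 by (simp add: 4 numeral_eq_Suc)
    have b: "h 1 \<le> 8" "h 2 \<le> h 1 + 10" "h 1 = 8 \<Longrightarrow> h 2 = h 1 + 10"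
      using h1 ineq extremal unfolding S by (simp_all add: 4)
    show ?thesis
      by (rule scaled_quadratic_critical_line[OF root]) (use h_bounds_4[OF b L2', folded F_def] in \<open>simp_all add: F_def\<close>)
  next
    case 5
    define F where "F = 1 + int (h 1) + int (h 2)"
    let ?u = "20 * (int (h 1) + 3) - 2 * F"
    have h3: "h 4 = h 1" "h 3 = h 2" using sym[of 1] sym[of 2] 5 by simp_all
    have F: "of_int F = 1 + real (h 1) + real (h 2)" "of_int ?u = 20 * (real (h 1) + 3) - 2 * of_int F"
      by (simp_all add: F_def)
    have "ehrhart_poly P = D * (smult (of_real (of_int F / of_int 120)) (Y\<^sup>2) + smult (of_real (of_int ?u / of_int 120)) Y + 1)"
      by (rule ehrhart_poly_eqI) (unfold count 5 ev F of_int_numeral, rule ehrhart_5[symmetric], use h0 hd h3 5 in auto)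
    then have roots: "1 + 2 * z = 0 \<or>
      of_real (of_int F / of_int 120) * (z\<^sup>2 + z)\<^sup>2 + of_real (of_int ?u / of_int 120) * (z\<^sup>2 + z) + 1 = 0"
      using assms(3) by (simp only: ev mult_eq_0_iff)
    have L2': "21 + 6 * h 1 + h 2 \<le> 1 + 2 * (h 1 + 5) + ((h 1 + 5) choose 2)"
      using L2 h0 by (simp add: L 5 numeral_eq_Suc)
    \<comment> \<open>The weights for \<open>i = 0, 1, 2\<close> are 65, 17, -7, and symmetrically
      for the rest.\<close>
    have S: "(\<Sum>i\<le>?d. real (h i) * (3 * (real ?d - 2 * real i)\<^sup>2 - 2 * real ?d)) = 2 * (65 + 17 * real (h 1) - 7 * real (h 2))"
      using h0 hd h3 by (simp add: 5 numeral_eq_Suc)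
    have b: "h 1 \<le> 10" "7 * h 2 \<le> 65 + 17 * h 1"
      using h1 ineq unfolding S by (simp_all add: 5)
    from roots show ?thesis
    proof
      assume root: "of_real (of_int F / of_int 120) * (z\<^sup>2 + z)\<^sup>2 + of_real (of_int ?u / of_int 120) * (z\<^sup>2 + z) + 1 = 0"
      show ?thesis
        by (rule scaled_quadratic_critical_line[OF root]) (use h_bounds_5[OF b L2', folded F_def] in \<open>simp_all add: F_def\<close>)
    qed (rule linear_factor_root)
  qed
qed

end
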